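(* Let $a_1,a_2$ be integers, not both zero, and let $L=\{(x_1,x_2)\in\mathbb{Z}^2:\ a_1x_1+a_2x_2=0\}$. Then, for the simple symmetric random walk on $\mathbb{Z}^2$ started at the origin, almost surely $$\frac{1}{8\pi}\le \liminf_{n\to\infty}\frac{\xi^{(2)}_L(n)}{(\log n)^2}\le \limsup_{n\to\infty}\frac{\xi^{(2)}_L(n)}{(\log n)^2}\le \frac{1}{2\pi}.$$
   Context: The simple symmetric random walk on $\mathbb{Z}^2$ is $\mathbf{S}_0=\mathbf{0}$, $\mathbf{S}_n=\sum_{k=1}^n\mathbf{X}_k$, where $\mathbf{X}_1,\mathbf{X}_2,\dots$ are i.i.d. with $\mathbf{P}(\mathbf{X}_1=\mathbf{e}_i)=\mathbf{P}(\mathbf{X}_1=-\mathbf{e}_i)=\frac14$ for $i=1,2$, and $\mathbf{e}_1,\mathbf{e}_2$ are the standard unit vectors of $\mathbb{Z}^2$. Its local time at $\mathbf{x}\in\mathbb{Z}^2$ is $\xi^{(2)}(\mathbf{x},n)=\#\{k:\ 0<k\le n,\ \mathbf{S}_k=\mathbf{x}\}$. For $A\subseteq\mathbb{Z}^2$, $\xi^{(2)}_A(n)=\max_{\mathbf{x}\in A}\xi^{(2)}(\mathbf{x},n)$. *)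

theory Defs
  imports "HOL-Probability.Probability"
begin

text \<open>The steps of the simple symmetric random walk on the square lattice are indexed from 1;
  \<open>X 0\<close> is unconstrained and never used.\<close>

locale simple_random_walk_2d = prob_space M
  for M :: "'a measure" +
  fixes X :: "nat \<Rightarrow> 'a \<Rightarrow> int \<times> int"
  assumes indep_steps: "indep_vars (\<lambda>_. count_space UNIV) X {1..}"
    and ident_distrib_steps:
      "\<And>k. k \<ge> 1 \<Longrightarrow> distr M (count_space UNIV) (X k) = distr M (count_space UNIV) (X 1)"
    and step_prob:
      "\<And>v. v \<in> {(1, 0), (-1, 0), (0, 1), (0, -1)} \<Longrightarrow> prob {\<omega> \<in> space M. X 1 \<omega> = v} = 1 / 4"

definition walk :: "(nat \<Rightarrow> 'a \<Rightarrow> int \<times> int) \<Rightarrow> nat \<Rightarrow> 'a \<Rightarrow> int \<times> int" where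
  "walk X n \<omega> = (\<Sum>k=1..n. X k \<omega>)"

definition local_time :: "(nat \<Rightarrow> 'a \<Rightarrow> int \<times> int) \<Rightarrow> int \<times> int \<Rightarrow> nat \<Rightarrow> 'a \<Rightarrow> nat" where
  "local_time X x n \<omega> = card {k. 0 < k \<and> k \<le> n \<and> walk X k \<omega> = x}"

text \<open>The set \<open>A\<close> may be infinite, but the set of values is bounded by \<open>n\<close> and hence finite
  (next lemma), so \<open>Max\<close> is the genuine maximum whenever \<open>A\<close> is nonempty.\<close>

definition max_local_time :: "(nat \<Rightarrow> 'a \<Rightarrow> int \<times> int) \<Rightarrow> (int \<times> int) set \<Rightarrow> nat \<Rightarrow> 'a \<Rightarrow> nat" where
  "max_local_time X A n \<omega> = Max ((\<lambda>x. local_time X x n \<omega>) ` A)"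

lemma finite_local_time_image: "finite ((\<lambda>x. local_time X x n \<omega>) ` A)"
proof (rule finite_subset)
  have "local_time X x n \<omega> \<le> n" for x
  proof -
    have "card {k. 0 < k \<and> k \<le> n \<and> walk X k \<omega> = x} \<le> card {1..n}"
      by (rule card_mono) auto
    then show ?thesis by (simp add: local_time_def)
  qed
  then show "(\<lambda>x. local_time X x n \<omega>) ` A \<subseteq> {..n}" by auto
qed simp

definition lattice_line :: "int \<Rightarrow> int \<Rightarrow> (int \<times> int) set" where
  "lattice_line a1 a2 = {(x1, x2). a1 * x1 + a2 * x2 = 0}"

end

theory Submission
  imports Defs "HOL-Real_Asymp.Real_Asymp"
begin

text \<open>Write \<open>\<xi>(x, n)\<close> for the local time at \<open>x\<close>, \<open>L\<close> for the line, \<open>G(n)\<close> for the expected number of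
  \<open>t \<le> n\<close> with \<open>S\<^sub>t = 0\<close>, and \<open>g(n)\<close> for the expected number of \<open>t \<le> n\<close> with \<open>S\<^sub>t \<in> L\<close>. The two
  quantities that decide everything are \<open>G(n) \<sim> (log n) / \<pi>\<close> (lemmas \<open>green_zero_lower\<close> and
  \<open>green_zero_upper\<close>) and \<open>g(n)\<close>, which is of order \<open>\<surd>n\<close> (lemmas \<open>green_lattice_line_upper\<close> and
  \<open>green_lattice_line_lower\<close>).

  Upper bound. The number of returns to a visited point has a nearly geometric tail with mean
  \<open>G(n)\<close>, so a visited point collects \<open>a log\<^sup>2 n\<close> visits with probability about \<open>n\<close> to the power
  \<open>- \<pi> a\<close>. At most \<open>g(n)\<close> points of \<open>L\<close> are visited on average. Hence some point of \<open>L\<close> is that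
  popular with probability about \<open>n\<close> to the power \<open>1/2 - \<pi> a\<close>, which is summable along powers of 2
  when \<open>a > 1/(2 \<pi>)\<close>. The exact form is \<open>prb_not_quiet_le\<close>, obtained from an exponential moment.

  Lower bound. From a point of \<open>L\<close>, attempt to return to it \<open>a log\<^sup>2 n\<close> times within \<open>b = \<surd>n\<close> steps.
  Such an attempt succeeds with probability \<open>p\<close> about \<open>n\<close> to the power \<open>- 2 \<pi> a\<close>: it is enough that
  the consecutive return times are all below \<open>b / (a log\<^sup>2 n)\<close>, whose logarithm is still about
  \<open>(log n)/2\<close> (lemma \<open>prb_many_returns_ge_green\<close>). After a failed attempt, wait for the first time
  \<open>\<tau> > b\<close> with \<open>S\<^sub>\<tau> \<in> L\<close> and start again. Decomposing at \<open>\<tau>\<close> gives a renewal inequality for the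
  probability that nothing has succeeded by time \<open>n\<close>; summing it over \<open>n\<close> (lemma \<open>prb_quiet_le\<close>)
  bounds this probability by \<open>E(min \<tau> n) / (p n)\<close>. Since \<open>P(\<tau> > m)\<close> is at most \<open>g(b) / g(m - b)\<close> by
  a last-exit decomposition, this is of order \<open>\<surd>(b/n) / p\<close>, that is, \<open>n\<close> to the power
  \<open>- 1/4 + 2 \<pi> a\<close>, summable along powers of 2 when \<open>a < 1/(8 \<pi>)\<close>. The choice \<open>b = \<surd>n\<close> is the best
  one for this method: with \<open>b\<close> equal to \<open>n\<close> to the power \<open>x\<close> the constant is \<open>x (1 - x) / (2 \<pi>)\<close>.

  The Borel-Cantelli lemma gives both bounds along \<open>n = 2\<^sup>j\<close>, and monotonicity in \<open>n\<close> fills the gaps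
  because \<open>log 2\<^sup>j\<close> and \<open>log 2\<^sup>j\<^sup>+\<^sup>1\<close> have ratio tending to 1.

  Only finitely many steps matter in each estimate, so all of them are carried out for uniformly
  distributed words over the four unit steps. The Markov property at a fixed time is then the fact
  that a uniform word splits into two independent uniform words (lemma \<open>avg_split\<close>).\<close>

section \<open>Averages over words of steps\<close>

definition steps :: "(int \<times> int) set" where
  "steps = {(1, 0), (-1, 0), (0, 1), (0, -1)}"

lemma sum_steps: "(\<Sum>s\<in>steps. f s) = f (1, 0) + f (-1, 0) + f (0, 1) + (f (0, -1) :: real)"
  by (simp add: steps_def)

text \<open>The mean of \<open>f\<close> over the uniformly distributed words of length \<open>n\<close> over the four unit steps; the
  recursion conditions on the first step.\<close>

primrec avg :: "nat \<Rightarrow> ((int \<times> int) list \<Rightarrow> real) \<Rightarrow> real" where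
  "avg 0 f = f []"
| "avg (Suc n) f = (\<Sum>s\<in>steps. avg n (\<lambda>w. f (s # w))) / 4"

lemma avg_mono: "(\<And>w. length w = n \<Longrightarrow> f w \<le> g w) \<Longrightarrow> avg n f \<le> avg n g"
  by (induction n arbitrary: f g) (auto intro!: sum_mono divide_right_mono)

lemma avg_cong: "(\<And>w. length w = n \<Longrightarrow> f w = g w) \<Longrightarrow> avg n f = avg n g"
  by (intro order_antisym avg_mono) auto

lemma avg_const [simp]: "avg n (\<lambda>_. c) = c"
  by (induction n) (simp_all add: sum_steps del: sum_constant)

lemma avg_nonneg: "(\<And>w. length w = n \<Longrightarrow> 0 \<le> f w) \<Longrightarrow> 0 \<le> avg n f"
  using avg_mono[of n "\<lambda>_. 0" f] by simp

lemma avg_add: "avg n (\<lambda>w. f w + g w) = avg n f + avg n g"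
  by (induction n arbitrary: f g) (simp_all add: sum_steps field_simps)

lemma avg_cmult: "avg n (\<lambda>w. c * f w) = c * avg n f"
  by (induction n arbitrary: f) (simp_all add: sum_steps field_simps)

lemma avg_diff: "avg n (\<lambda>w. f w - g w) = avg n f - avg n g"
  using avg_add[of n f "\<lambda>w. -1 * g w"] avg_cmult[of n "-1" g] by simp

lemma avg_sum: "avg n (\<lambda>w. \<Sum>i\<in>I. f i w) = (\<Sum>i\<in>I. avg n (f i))"
  by (induction I rule: infinite_finite_induct) (simp_all add: avg_add)

lemma avg_append: "avg (m + n) f = avg m (\<lambda>u. avg n (\<lambda>v. f (u @ v)))"
  by (induction m arbitrary: f) simp_all

text \<open>The Markov property at time \<open>t\<close>.\<close>

lemma avg_split:
  assumes "t \<le> n"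
  shows "avg n (\<lambda>w. f (take t w) * g (drop t w)) = avg t f * avg (n - t) g"
proof -
  have "avg (t + (n - t)) (\<lambda>w. f (take t w) * g (drop t w)) = avg t (\<lambda>u. avg (n - t) g * f u)"
    unfolding avg_append by (intro avg_cong) (simp add: avg_cmult)
  then show ?thesis using assms by (simp add: avg_cmult)
qed

lemma avg_take: "t \<le> n \<Longrightarrow> avg n (\<lambda>w. f (take t w)) = avg t f"
  using avg_split[of t n f "\<lambda>_. 1"] by simp

lemma avg_product: "avg m (\<lambda>u. avg n (\<lambda>v. f u * g v)) = avg m f * avg n g"
proof -
  have "(\<lambda>u. avg n (\<lambda>v. f u * g v)) = (\<lambda>u. avg n g * f u)"
    by (simp add: avg_cmult mult.commute)
  then show ?thesis by (simp add: avg_cmult)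
qed

definition prb :: "nat \<Rightarrow> ((int \<times> int) list \<Rightarrow> bool) \<Rightarrow> real" where
  "prb n A = avg n (\<lambda>w. of_bool (A w))"

lemma prb_mono: "(\<And>w. length w = n \<Longrightarrow> A w \<Longrightarrow> B w) \<Longrightarrow> prb n A \<le> prb n B"
  unfolding prb_def by (intro avg_mono) (auto simp: of_bool_def)

lemma prb_take_mono:
  assumes "m \<le> n" "\<And>w. A (take m w) \<Longrightarrow> A w"
  shows "prb m A \<le> prb n A"
proof -
  have "prb m A = avg n (\<lambda>w. of_bool (A (take m w)))"
    unfolding prb_def using assms(1) by (rule avg_take[symmetric])
  also have "\<dots> \<le> prb n A"
    unfolding prb_def using assms(2) by (intro avg_mono) (auto simp: of_bool_def)
  finally show ?thesis .
qed

lemma prb_nonneg [simp]: "0 \<le> prb n A"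
  unfolding prb_def by (intro avg_nonneg) auto

lemma prb_not: "prb n (\<lambda>w. \<not> A w) = 1 - prb n A"
proof -
  have "(\<lambda>w. of_bool (\<not> A w) :: real) = (\<lambda>w. 1 - of_bool (A w))" by (auto simp: of_bool_def)
  then show ?thesis unfolding prb_def by (simp add: avg_diff)
qed

lemma prb_le_1 [simp]: "prb n A \<le> 1"
  using prb_nonneg[of n "\<lambda>w. \<not> A w"] by (simp add: prb_not del: prb_nonneg)

lemma prb_True [simp]: "prb n (\<lambda>_. True) = 1"
  by (simp add: prb_def)

section \<open>Last-exit decomposition\<close>

text \<open>Relative to a subgroup \<open>K\<close>, a walk that stands in \<open>K\<close> sees the same future visits to \<open>K\<close> as a walk
  started at the origin. The renewal arguments rest on this, both for \<open>{0}\<close> and for the line.\<close>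

definition additive_subgroup :: "(int \<times> int) set \<Rightarrow> bool" where
  "additive_subgroup K \<longleftrightarrow> 0 \<in> K \<and> (\<forall>x\<in>K. \<forall>y. x + y \<in> K \<longleftrightarrow> y \<in> K)"

lemma additive_subgroup_zero: "additive_subgroup {0}"
  by (simp add: additive_subgroup_def)

lemma additive_subgroup_lattice_line: "additive_subgroup (lattice_line a1 a2)"
  unfolding additive_subgroup_def lattice_line_def
  by (auto simp: zero_prod_def algebra_simps)

lemma lattice_line_nonempty: "lattice_line a1 a2 \<noteq> {}"
  using additive_subgroup_lattice_line[of a1 a2] unfolding additive_subgroup_def by blast

lemma sum_list_take_add:
  "sum_list (take (t + j) w) = sum_list (take t w) + sum_list (take j (drop t w))"
  for w :: "(int \<times> int) list"
  by (simp add: take_add)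

definition avoids :: "(int \<times> int) set \<Rightarrow> nat \<Rightarrow> (int \<times> int) list \<Rightarrow> bool" where
  "avoids K c w \<longleftrightarrow> (\<forall>t. c < t \<and> t \<le> length w \<longrightarrow> sum_list (take t w) \<notin> K)"

lemma avoids_drop:
  assumes "additive_subgroup K" "sum_list (take t w) \<in> K" "t \<le> length w"
  shows "avoids K t w \<longleftrightarrow> avoids K 0 (drop t w)"
proof -
  have *: "sum_list (take (t + j) w) \<in> K \<longleftrightarrow> sum_list (take j (drop t w)) \<in> K" for j
    using assms unfolding additive_subgroup_def sum_list_take_add by blast
  show ?thesis
  proof
    assume L: "avoids K t w"
    show "avoids K 0 (drop t w)" unfolding avoids_def
    proof (intro allI impI)
      fix j assume "0 < j \<and> j \<le> length (drop t w)"
      then have "sum_list (take (t + j) w) \<notin> K" using L assms(3) unfolding avoids_def by force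
      then show "sum_list (take j (drop t w)) \<notin> K" using * by simp
    qed
  next
    assume R: "avoids K 0 (drop t w)"
    show "avoids K t w" unfolding avoids_def
    proof (intro allI impI)
      fix i assume i: "t < i \<and> i \<le> length w"
      then have "sum_list (take (i - t) (drop t w)) \<notin> K" using R unfolding avoids_def by force
      then show "sum_list (take i w) \<notin> K" using *[of "i - t"] i by simp
    qed
  qed
qed

lemma sum_of_bool_unique:
  assumes "finite T" "\<And>s t. s \<in> T \<Longrightarrow> t \<in> T \<Longrightarrow> A s \<Longrightarrow> A t \<Longrightarrow> s = t"
  shows "(\<Sum>t\<in>T. of_bool (A t)) = (of_bool (\<exists>t\<in>T. A t) :: real)"
proof (cases "\<exists>t\<in>T. A t")
  case True
  then obtain t where t: "t \<in> T" "A t" by blast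
  then have "T \<inter> Collect A = {t}" using assms(2) by blast
  then show ?thesis using t assms(1) by (auto simp: sum_of_bool_eq)
next
  case False
  then show ?thesis by (auto intro!: sum.neutral)
qed

text \<open>Exactly one \<open>t \<le> c\<close> is the last visit to \<open>K\<close> up to time \<open>c\<close>, time 0 being a visit, and \<open>K\<close> is avoided
  after \<open>c\<close> exactly if it is avoided after that \<open>t\<close>.\<close>

lemma avoids_last_visit:
  assumes "0 \<in> K" "c \<le> length w"
  shows "of_bool (avoids K c w)
    = (\<Sum>t\<le>c. of_bool (sum_list (take t w) \<in> K) * (of_bool (avoids K t w) :: real))"
proof -
  let ?A = "\<lambda>t. sum_list (take t w) \<in> K \<and> avoids K t w"
  have uniq: "s = t" if "s \<in> {..c}" "t \<in> {..c}" "?A s" "?A t" for s t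
    using that assms unfolding avoids_def by (metis atMost_iff dual_order.trans linorder_neqE_nat)
  have "avoids K c w \<longleftrightarrow> (\<exists>t\<in>{..c}. ?A t)"
  proof
    assume L: "avoids K c w"
    let ?T = "{t. t \<le> c \<and> sum_list (take t w) \<in> K}"
    have fin: "finite ?T" and ne: "?T \<noteq> {}"
      using assms(1) by (auto intro!: exI[of _ 0])
    have "Max ?T \<in> ?T" using Max_in[OF fin ne] .
    moreover have "avoids K (Max ?T) w"
      unfolding avoids_def
    proof (intro allI impI)
      fix t assume t: "Max ?T < t \<and> t \<le> length w"
      then have "t \<notin> ?T" using Max_ge[OF fin, of t] by linarith
      then show "sum_list (take t w) \<notin> K" using L t unfolding avoids_def by auto
    qed
    ultimately show "\<exists>t\<in>{..c}. ?A t" by blast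
  qed (auto simp: avoids_def)
  then have "of_bool (avoids K c w) = (\<Sum>t\<le>c. of_bool (?A t) :: real)"
    using sum_of_bool_unique[of "{..c}" ?A] uniq by auto
  then show ?thesis by (simp add: of_bool_conj)
qed

definition green :: "(int \<times> int) set \<Rightarrow> nat \<Rightarrow> real" where
  "green K n = (\<Sum>t\<le>n. prb t (\<lambda>w. sum_list w \<in> K))"

definition escape :: "(int \<times> int) set \<Rightarrow> nat \<Rightarrow> real" where
  "escape K n = prb n (avoids K 0)"

lemma last_visit_decomposition:
  assumes "additive_subgroup K" "c \<le> n"
  shows "prb n (avoids K c) = (\<Sum>t\<le>c. prb t (\<lambda>w. sum_list w \<in> K) * escape K (n - t))"
proof -
  have "prb n (avoids K c)
    = avg n (\<lambda>w. \<Sum>t\<le>c. of_bool (sum_list (take t w) \<in> K) * of_bool (avoids K 0 (drop t w)))"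
    unfolding prb_def
  proof (rule avg_cong)
    fix w :: "(int \<times> int) list" assume w: "length w = n"
    have "of_bool (avoids K c w)
      = (\<Sum>t\<le>c. of_bool (sum_list (take t w) \<in> K) * (of_bool (avoids K t w) :: real))"
      using assms w by (intro avoids_last_visit) (auto simp: additive_subgroup_def)
    also have "\<dots> = (\<Sum>t\<le>c. of_bool (sum_list (take t w) \<in> K)
        * (of_bool (avoids K 0 (drop t w)) :: real))"
    proof (rule sum.cong[OF refl])
      fix t assume "t \<in> {..c}"
      then have "t \<le> length w" using assms w by simp
      then show "of_bool (sum_list (take t w) \<in> K) * (of_bool (avoids K t w) :: real)
        = of_bool (sum_list (take t w) \<in> K) * of_bool (avoids K 0 (drop t w))"
        using avoids_drop[OF assms(1), of t w] by (cases "sum_list (take t w) \<in> K") simp_all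
    qed
    finally show "of_bool (avoids K c w) = (\<Sum>t\<le>c. of_bool (sum_list (take t w) \<in> K)
        * (of_bool (avoids K 0 (drop t w)) :: real))" .
  qed
  also have "\<dots> = (\<Sum>t\<le>c. prb t (\<lambda>w. sum_list w \<in> K) * escape K (n - t))"
    unfolding avg_sum escape_def prb_def
  proof (rule sum.cong[OF refl])
    fix t assume "t \<in> {..c}"
    then show "avg n (\<lambda>w. of_bool (sum_list (take t w) \<in> K) * of_bool (avoids K 0 (drop t w)))
      = avg t (\<lambda>w. of_bool (sum_list w \<in> K)) * avg (n - t) (\<lambda>w. of_bool (avoids K 0 w))"
      using assms(2) by (intro avg_split) simp
  qed
  finally show ?thesis .
qed

lemma escape_antimono:
  assumes "m \<le> n" shows "escape K n \<le> escape K m"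
proof -
  have "escape K m = avg n (\<lambda>w. of_bool (avoids K 0 (take m w)))"
    unfolding escape_def prb_def using assms by (rule avg_take[symmetric])
  then show ?thesis unfolding escape_def prb_def using assms
    by (auto simp: avoids_def min_def intro!: avg_mono split: if_splits)
qed

lemma green_pos:
  assumes "additive_subgroup K" shows "green K n \<ge> 1"
proof -
  have "prb 0 (\<lambda>w. sum_list w \<in> K) = 1"
    using assms by (simp add: prb_def additive_subgroup_def)
  moreover have "prb 0 (\<lambda>w. sum_list w \<in> K) \<le> green K n"
    unfolding green_def by (rule member_le_sum) auto
  ultimately show ?thesis by simp
qed

lemma escape_nonneg [simp]: "0 \<le> escape K n"
  by (simp add: escape_def)

text \<open>The last visit to \<open>K\<close> up to time \<open>n\<close> happens somewhere, so the probabilities in the last-exit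
  decomposition at \<open>c = n\<close> add up to 1, and each escape factor there is at least the one for \<open>n\<close>.\<close>

lemma escape_le_inverse_green:
  assumes "additive_subgroup K" shows "escape K n \<le> 1 / green K n"
proof -
  have "prb n (\<lambda>_. True) \<le> prb n (avoids K n)"
    by (rule prb_mono) (auto simp: avoids_def)
  then have "1 = prb n (avoids K n)" using prb_le_1[of n "avoids K n"] by simp
  also have "\<dots> = (\<Sum>t\<le>n. prb t (\<lambda>w. sum_list w \<in> K) * escape K (n - t))"
    using assms by (rule last_visit_decomposition) simp
  also have "\<dots> \<ge> green K n * escape K n"
    unfolding green_def sum_distrib_right
    by (intro sum_mono mult_left_mono escape_antimono) auto
  finally show ?thesis
    using green_pos[OF assms, of n] by (simp add: field_simps)
qed

lemma prb_avoids_le: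
  assumes "additive_subgroup K" "c \<le> n"
  shows "prb n (avoids K c) \<le> green K c / green K (n - c)"
proof -
  have "prb n (avoids K c) = (\<Sum>t\<le>c. prb t (\<lambda>w. sum_list w \<in> K) * escape K (n - t))"
    using assms by (rule last_visit_decomposition)
  also have "\<dots> \<le> green K c * escape K (n - c)"
    unfolding green_def sum_distrib_right using assms(2)
    by (intro sum_mono mult_left_mono escape_antimono) auto
  also have "\<dots> \<le> green K c * (1 / green K (n - c))"
    using green_pos[OF assms(1), of c] by (intro mult_left_mono escape_le_inverse_green assms) auto
  finally show ?thesis by simp
qed

section \<open>Return probabilities of the planar walk\<close>

primrec avg1 :: "nat \<Rightarrow> (int \<Rightarrow> real) \<Rightarrow> real" where
  "avg1 0 f = f 0"
| "avg1 (Suc n) f = (avg1 n (\<lambda>u. f (u + 1)) + avg1 n (\<lambda>u. f (u - 1))) / 2"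

lemma avg1_mono: "(\<And>u. f u \<le> g u) \<Longrightarrow> avg1 n f \<le> avg1 n g"
  by (induction n arbitrary: f g) (auto intro!: divide_right_mono add_mono)

lemma avg1_const [simp]: "avg1 n (\<lambda>_. c) = c"
  by (induction n) simp_all

lemma avg1_add: "avg1 n (\<lambda>u. f u + g u) = avg1 n f + avg1 n g"
  by (induction n arbitrary: f g) (simp_all add: field_simps)

lemma avg1_cmult: "avg1 n (\<lambda>u. c * f u) = c * avg1 n f"
  by (induction n arbitrary: f) (simp_all add: field_simps)

lemma avg1_half: "avg1 n (\<lambda>u. (f u + g u) / 2) = (avg1 n f + avg1 n g) / 2"
  using avg1_cmult[of n "1/2" "\<lambda>u. f u + g u"] by (simp add: avg1_add)

lemma avg1_swap: "avg1 n (\<lambda>u. avg1 m (\<lambda>v. h u v)) = avg1 m (\<lambda>v. avg1 n (\<lambda>u. h u v))"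
  by (induction n arbitrary: h) (simp_all add: avg1_half)

text \<open>The coordinates \<open>x + y\<close> and \<open>x - y\<close> of the planar walk are independent simple random walks on the
  integers: each of the four steps corresponds to one of the four pairs of signs.\<close>

lemma avg_rotate:
  "avg n (\<lambda>w. h (fst (sum_list w) + snd (sum_list w)) (fst (sum_list w) - snd (sum_list w)))
    = avg1 n (\<lambda>u. avg1 n (\<lambda>v. h u v))"
proof (induction n arbitrary: h)
  case 0
  then show ?case by simp
next
  case (Suc n)
  have "avg n (\<lambda>w. h (fst (sum_list (s # w)) + snd (sum_list (s # w)))
        (fst (sum_list (s # w)) - snd (sum_list (s # w))))
      = avg1 n (\<lambda>u. avg1 n (\<lambda>v. h (u + (fst s + snd s)) (v + (fst s - snd s))))" for s
    using Suc.IH[of "\<lambda>u v. h (u + (fst s + snd s)) (v + (fst s - snd s))"]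
    by (simp add: algebra_simps)
  then show ?case by (simp only: avg.simps sum_steps, simp add: avg1_half, simp add: add_divide_distrib)
qed

definition kernel1 :: "nat \<Rightarrow> int \<Rightarrow> real" where
  "kernel1 n u = avg1 n (\<lambda>x. of_bool (x = u))"

lemma kernel1_0: "kernel1 0 u = of_bool (u = 0)"
  by (auto simp: kernel1_def)

lemma kernel1_Suc: "kernel1 (Suc n) u = (kernel1 n (u - 1) + kernel1 n (u + 1)) / 2"
proof -
  have "(\<lambda>x. of_bool (x + 1 = u) :: real) = (\<lambda>x. of_bool (x = u - 1))"
    "(\<lambda>x. of_bool (x - 1 = u) :: real) = (\<lambda>x. of_bool (x = u + 1))"
    by (auto simp: algebra_simps)
  then show ?thesis by (simp add: kernel1_def)
qed

lemma kernel1_binomial: "kernel1 n (2 * int k - int n) = real (n choose k) / 2 ^ n"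
  and kernel1_below: "u < - int n \<Longrightarrow> kernel1 n u = 0"
  and kernel1_parity: "odd (int n + u) \<Longrightarrow> kernel1 n u = 0"
proof (induction n arbitrary: k u)
  case 0
  { case 1 then show ?case by (cases k) (auto simp: kernel1_0) }
  { case 2 then show ?case by (simp add: kernel1_0) }
  { case 3 then show ?case by (auto simp: kernel1_0) }
next
  case (Suc n)
  { case 1
    show ?case
    proof (cases k)
      case 0
      then show ?thesis using Suc.IH(1)[of 0] Suc.IH(2)[of "- int n - 2"]
        by (simp add: kernel1_Suc algebra_simps)
    next
      case (Suc k')
      have e1: "2 * int k - int (Suc n) - 1 = 2 * int k' - int n"
        and e2: "2 * int k - int (Suc n) + 1 = 2 * int k - int n" using Suc by simp_all
      have "kernel1 (Suc n) (2 * int k - int (Suc n)) =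
          (kernel1 n (2 * int k' - int n) + kernel1 n (2 * int k - int n)) / 2"
        unfolding kernel1_Suc e1 e2 by (rule refl)
      then show ?thesis unfolding Suc.IH(1) by (simp add: Suc field_simps)
    qed }
  { case 2 then show ?case using Suc.IH(2)[of "u - 1"] Suc.IH(2)[of "u + 1"] by (simp add: kernel1_Suc) }
  { case 3 then show ?case using Suc.IH(3)[of "u - 1"] Suc.IH(3)[of "u + 1"] by (simp add: kernel1_Suc) }
qed

text \<open>The return probability of the one-dimensional walk at time \<open>2 j\<close>.\<close>

definition central :: "nat \<Rightarrow> real" where
  "central j = real (2 * j choose j) / 4 ^ j"

lemma central_pos: "0 < central j"
  by (simp add: central_def)

lemma central_Suc: "central (Suc j) = central j * (2 * real j + 1) / (2 * real j + 2)"
proof -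
  have "Suc j * (2 * Suc j choose Suc j) = 2 * (2 * j + 1) * (2 * j choose j)"
  proof -
    have a: "Suc j * (Suc (2 * j) choose Suc j) = Suc (2 * j) * (2 * j choose j)"
      by (rule Suc_times_binomial_eq[of "2 * j" j, symmetric, unfolded mult.commute[of _ "Suc j"]])
    have b: "(Suc (2 * j) choose j) = (Suc (2 * j) choose Suc j)"
      by (subst binomial_symmetric) auto
    have "2 * Suc j choose Suc j = 2 * (Suc (2 * j) choose Suc j)"
      using b by (simp add: numeral_2_eq_2)
    then show ?thesis using a by (simp del: binomial_Suc_Suc)
  qed
  then have "real (Suc j) * real (2 * Suc j choose Suc j) = 2 * (2 * real j + 1) * real (2 * j choose j)"
    by (metis (mono_tags, lifting) of_nat_1 of_nat_add of_nat_mult of_nat_numeral)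
  then have *: "real (2 * Suc j choose Suc j) = 2 * (2 * real j + 1) * real (2 * j choose j) / real (Suc j)"
    by (metis nonzero_mult_div_cancel_left of_nat_neq_0)
  show ?thesis unfolding central_def * by (simp add: divide_simps) (simp add: algebra_simps)
qed

text \<open>The Wallis product, solved for the central binomial coefficient. It supplies the constant \<open>\<pi>\<close>.\<close>

lemma central_wallis:
  "(2 * real j + 1) * (central j)\<^sup>2 * (\<Prod>k=1..j. (4 * real k ^ 2) / (4 * real k ^ 2 - 1)) = 1"
proof (induction j)
  case 0
  then show ?case by (simp add: central_def)
next
  case (Suc j)
  let ?W = "\<lambda>j. \<Prod>k=1..j. (4 * real k ^ 2) / (4 * real k ^ 2 - 1)"
  have W: "?W (Suc j) = ?W j * ((2 * real j + 2)\<^sup>2 / ((2 * real j + 1) * (2 * real j + 3)))"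
    by (simp add: power2_eq_square algebra_simps)
  have "(2 * real (Suc j) + 1) * (central (Suc j))\<^sup>2 * ?W (Suc j)
    = (2 * real j + 1) * (central j)\<^sup>2 * ?W j"
    unfolding W central_Suc by (simp add: divide_simps power2_eq_square)
  then show ?case by (simp only: Suc.IH)
qed

lemma central_sq_limit: "(\<lambda>j. (2 * real j + 1) * (central j)\<^sup>2) \<longlonglongrightarrow> 2 / pi"
proof -
  have "(\<lambda>j. (2 * real j + 1) * (central j)\<^sup>2)
    = (\<lambda>j. inverse (\<Prod>k=1..j. (4 * real k ^ 2) / (4 * real k ^ 2 - 1)))"
    using central_wallis by (intro ext inverse_unique[symmetric]) (simp add: mult.commute)
  then show ?thesis using tendsto_inverse[OF wallis] by simp
qed

text \<open>The sequence \<open>(2 j + 1) (central j)\<^sup>2\<close> decreases to its limit; below, \<open>j (central j)\<^sup>2\<close> increases to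
  its limit. Monotonicity turns the asymptotics into bounds for every \<open>j\<close>.\<close>

lemma central_sq_lower: "2 / pi / (2 * real j + 1) \<le> (central j)\<^sup>2"
proof -
  have "decseq (\<lambda>j. (2 * real j + 1) * (central j)\<^sup>2)"
  proof (rule decseq_SucI)
    fix j
    have "(2 * real (Suc j) + 1) * (central (Suc j))\<^sup>2
      = (2 * real j + 1) * (central j)\<^sup>2 * ((2 * real j + 1) * (2 * real j + 3) / (2 * real j + 2)\<^sup>2)"
      unfolding central_Suc by (simp add: divide_simps power2_eq_square)
    also have "(2 * real j + 1) * (2 * real j + 3) \<le> (2 * real j + 2)\<^sup>2"
      by (simp add: power2_eq_square algebra_simps)
    then have "(2 * real j + 1) * (2 * real j + 3) / (2 * real j + 2)\<^sup>2 \<le> 1"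
      by (subst pos_divide_le_eq) (auto intro!: zero_less_power)
    then have "(2 * real j + 1) * (central j)\<^sup>2 * ((2 * real j + 1) * (2 * real j + 3) / (2 * real j + 2)\<^sup>2)
      \<le> (2 * real j + 1) * (central j)\<^sup>2 * 1"
      by (rule mult_left_mono) simp
    finally show "(2 * real (Suc j) + 1) * (central (Suc j))\<^sup>2 \<le> (2 * real j + 1) * (central j)\<^sup>2" by simp
  qed
  from decseq_ge[OF this central_sq_limit, of j] show ?thesis
    by (subst pos_divide_le_eq) (auto simp: mult.commute)
qed

lemma central_sq_upper: "(central j)\<^sup>2 \<le> 1 / (pi * real j)" if "j > 0"
proof -
  have "incseq (\<lambda>j. real j * (central j)\<^sup>2)"
  proof (rule incseq_SucI)
    fix j
    have "real j * (2 * real j + 2)\<^sup>2 \<le> (real j + 1) * (2 * real j + 1)\<^sup>2"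
      by (simp add: power2_eq_square algebra_simps)
    then have "real j \<le> (real j + 1) * (2 * real j + 1)\<^sup>2 / (2 * real j + 2)\<^sup>2"
      by (subst pos_le_divide_eq) auto
    then have "(central j)\<^sup>2 * real j
        \<le> (central j)\<^sup>2 * ((real j + 1) * (2 * real j + 1)\<^sup>2 / (2 * real j + 2)\<^sup>2)"
      by (rule mult_left_mono) simp
    then show "real j * (central j)\<^sup>2 \<le> real (Suc j) * (central (Suc j))\<^sup>2"
      unfolding central_Suc by (simp add: power_divide power_mult_distrib mult_ac add_ac)
  qed
  moreover have "(\<lambda>j. real j * (central j)\<^sup>2) \<longlonglongrightarrow> 1 / pi"
  proof -
    have "(\<lambda>j. real j / (2 * real j + 1)) \<longlonglongrightarrow> 1 / 2" by real_asymp
    from tendsto_mult[OF this central_sq_limit]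
    have "(\<lambda>j. real j / (2 * real j + 1) * ((2 * real j + 1) * (central j)\<^sup>2)) \<longlonglongrightarrow> 1 / pi" by simp
    moreover have "real j / (2 * real j + 1) * ((2 * real j + 1) * (central j)\<^sup>2) = real j * (central j)\<^sup>2" for j
      by (simp add: field_simps)
    ultimately show ?thesis by simp
  qed
  ultimately have "real j * (central j)\<^sup>2 \<le> 1 / pi" by (rule incseq_le)
  then show ?thesis using that by (simp add: field_simps)
qed

lemma central_le: "central j \<le> 1 / sqrt (2 * real j + 1)"
proof -
  have "(2 * real j + 1) * (central j)\<^sup>2 * 1
    \<le> (2 * real j + 1) * (central j)\<^sup>2 * (\<Prod>k=1..j. (4 * real k ^ 2) / (4 * real k ^ 2 - 1))"
  proof (intro mult_left_mono prod_ge_1)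
    fix k assume "k \<in> {1..j}"
    then have "1 \<le> (real k)\<^sup>2" by simp
    then have "0 < 4 * (real k)\<^sup>2 - 1" by linarith
    then show "1 \<le> (4 * real k ^ 2) / (4 * real k ^ 2 - 1)" by (simp add: field_simps)
  qed auto
  then have "(2 * real j + 1) * (central j)\<^sup>2 \<le> 1"
    by (simp only: central_wallis mult_1_right)
  then have "(central j)\<^sup>2 \<le> (1 / sqrt (2 * real j + 1))\<^sup>2" by (simp add: field_simps power_divide)
  then show ?thesis by (rule power2_le_imp_le) simp
qed

text \<open>At even times the central binomial coefficient dominates; a step to an odd time averages two values
  of the kernel at the preceding even time.\<close>

lemma kernel1_le: "kernel1 n u \<le> 1 / sqrt (real n)" if "n > 0"
proof -
  have even: "kernel1 (2 * j) u \<le> central j" for j u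
  proof (cases "even u \<and> u \<ge> - int (2 * j)")
    case True
    then obtain m where "u = 2 * m" by (elim conjE evenE)
    with True have "u = 2 * int (nat (m + int j)) - int (2 * j)" by simp
    then obtain k where "u = 2 * int k - int (2 * j)" ..
    then have "kernel1 (2 * j) u = real (2 * j choose k) / 2 ^ (2 * j)"
      by (simp only: kernel1_binomial)
    also have "\<dots> \<le> central j"
      unfolding central_def by (simp add: power_mult divide_right_mono binomial_maximum')
    finally show ?thesis .
  next
    case False
    then have "kernel1 (2 * j) u = 0"
      using kernel1_below[of u "2 * j"] kernel1_parity[of "2 * j" u] by auto
    then show ?thesis using central_pos[of j] by simp
  qed
  have "kernel1 n u \<le> central (n div 2)"
  proof (cases "even n")
    case True
    then show ?thesis using even[of "n div 2" u] by simp
  next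
    case False
    then obtain j where n: "n = Suc (2 * j)" by (metis oddE Suc_eq_plus1)
    show ?thesis unfolding n using even[of j "u - 1"] even[of j "u + 1"] by (simp add: kernel1_Suc)
  qed
  also have "\<dots> \<le> 1 / sqrt (2 * real (n div 2) + 1)" by (rule central_le)
  also have "\<dots> \<le> 1 / sqrt (real n)"
  proof (intro divide_left_mono)
    have "real n \<le> 2 * real (n div 2) + 1" by linarith
    then show "sqrt (real n) \<le> sqrt (2 * real (n div 2) + 1)" by (rule real_sqrt_le_mono)
  qed (use that in auto)
  finally show ?thesis .
qed

lemma prb_at_origin: "prb n (\<lambda>w. sum_list w \<in> {0}) = (kernel1 n 0)\<^sup>2"
proof -
  have "prb n (\<lambda>w. sum_list w \<in> {0}) = avg n (\<lambda>w. (\<lambda>u v. of_bool (u = 0) * of_bool (v = 0))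
      (fst (sum_list w) + snd (sum_list w)) (fst (sum_list w) - snd (sum_list w)))"
    unfolding prb_def by (intro avg_cong) (auto simp: prod_eq_iff of_bool_def)
  also have "\<dots> = avg1 n (\<lambda>u. avg1 n (\<lambda>v. of_bool (u = 0) * of_bool (v = 0)))"
    by (rule avg_rotate)
  also have "\<dots> = (kernel1 n 0)\<^sup>2"
    by (simp add: avg1_cmult kernel1_def power2_eq_square avg1_cmult[of n "avg1 n f" for f, simplified mult.commute])
  finally show ?thesis .
qed

lemma prb_at_origin_even: "prb (2 * j) (\<lambda>w. sum_list w \<in> {0}) = (central j)\<^sup>2"
  using kernel1_binomial[of "2 * j" j] by (simp only: prb_at_origin central_def power_mult) simp

lemma prb_at_origin_odd: "odd n \<Longrightarrow> prb n (\<lambda>w. sum_list w \<in> {0}) = 0"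
  using kernel1_parity[of n 0] by (simp only: prb_at_origin) simp

lemma green_zero_eq: "green {0} n = (\<Sum>j\<le>n div 2. (central j)\<^sup>2)"
proof (induction n)
  case 0
  then show ?case using prb_at_origin_even[of 0] by (simp add: green_def)
next
  case (Suc n)
  have "green {0} (Suc n) = green {0} n + prb (Suc n) (\<lambda>w. sum_list w \<in> {0})"
    by (simp add: green_def)
  also have "\<dots> = (\<Sum>j\<le>Suc n div 2. (central j)\<^sup>2)"
  proof (cases "even n")
    case True
    then show ?thesis using Suc.IH prb_at_origin_odd[of "Suc n"] by simp
  next
    case False
    then obtain i where "n = Suc (2 * i)" by (metis oddE Suc_eq_plus1)
    then show ?thesis using Suc.IH prb_at_origin_even[of "Suc i"] by simp
  qed
  finally show ?case .
qed

text \<open>The return probability at time \<open>2 j\<close> is at least \<open>(2/\<pi>) / (2 j + 1)\<close>, and the sum of \<open>1 / (2 j + 1)\<close>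
  over \<open>j \<le> n/2\<close> is at least \<open>(log n) / 2\<close>.\<close>

lemma green_zero_lower:
  assumes "n > 0" shows "ln (real n) / pi \<le> green {0} n"
proof -
  have odd_harmonic: "ln (2 * real J + 3) / 2 \<le> (\<Sum>j\<le>J. 1 / (2 * real j + 1))" for J
  proof (induction J)
    case 0
    have "ln (1 + 2 :: real) \<le> 2" by (rule ln_add_one_self_le_self) simp
    then show ?case by simp
  next
    case (Suc J)
    have "2 * real J + 3 \<noteq> 0" by linarith
    then have "2 * real (Suc J) + 3 = (2 * real J + 3) * (1 + 2 / (2 * real J + 3))"
      by (simp add: distrib_left divide_eq_eq)
    then have "ln (2 * real (Suc J) + 3) = ln ((2 * real J + 3) * (1 + 2 / (2 * real J + 3)))" by simp
    also have "\<dots> = ln (2 * real J + 3) + ln (1 + 2 / (2 * real J + 3))"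
      by (intro ln_mult_pos) (auto intro: add_pos_nonneg)
    also have "ln (1 + 2 / (2 * real J + 3)) \<le> 2 / (2 * real J + 3)"
      by (rule ln_add_one_self_le_self) simp
    finally show ?case using Suc.IH by (simp add: add.commute)
  qed
  have "ln (real n) / 2 \<le> ln (2 * real (n div 2) + 3) / 2"
  proof (intro divide_right_mono ln_mono)
    show "real n \<le> 2 * real (n div 2) + 3" by linarith
  qed (use assms in auto)
  also note odd_harmonic[of "n div 2"]
  finally have "ln (real n) / pi \<le> 2 / pi * (\<Sum>j\<le>n div 2. 1 / (2 * real j + 1))"
    by (simp add: field_simps)
  also have "\<dots> \<le> (\<Sum>j\<le>n div 2. (central j)\<^sup>2)"
    unfolding sum_distrib_left using central_sq_lower by (intro sum_mono) simp
  finally show ?thesis by (simp only: green_zero_eq)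
qed

lemma green_zero_upper:
  assumes "n > 0" shows "green {0} n - 1 \<le> (1 + ln (real n)) / pi"
proof -
  have harmonic: "(\<Sum>j=1..Suc J. 1 / real j) \<le> 1 + ln (real (Suc J))" for J
  proof (induction J)
    case 0
    then show ?case by simp
  next
    case (Suc J)
    have "ln (real (Suc J) / real (Suc (Suc J))) \<le> real (Suc J) / real (Suc (Suc J)) - 1"
      by (intro ln_le_minus_one) simp
    also have "\<dots> = - (1 / real (Suc (Suc J)))" by (simp add: field_simps)
    finally have "1 / real (Suc (Suc J)) \<le> ln (real (Suc (Suc J))) - ln (real (Suc J))"
      by (simp add: ln_div)
    then show ?case using Suc.IH by simp
  qed
  have "(\<Sum>j\<le>J. (central j)\<^sup>2) = 1 + (\<Sum>j=1..J. (central j)\<^sup>2)" for J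
    by (induction J) (simp_all add: central_def)
  then have "green {0} n - 1 = (\<Sum>j=1..n div 2. (central j)\<^sup>2)" by (simp add: green_zero_eq)
  also have "\<dots> \<le> (\<Sum>j=1..n div 2. 1 / pi * (1 / real j))"
    using central_sq_upper by (intro sum_mono) auto
  also have "\<dots> = 1 / pi * (\<Sum>j=1..n div 2. 1 / real j)" by (simp only: sum_distrib_left)
  also have "\<dots> \<le> 1 / pi * (1 + ln (real n))"
  proof (rule mult_left_mono)
    show "(\<Sum>j=1..n div 2. 1 / real j) \<le> 1 + ln (real n)"
    proof (cases "n div 2")
      case 0
      then show ?thesis using assms by simp
    next
      case (Suc J)
      have "ln (real (Suc J)) \<le> ln (real n)" using Suc assms by (intro ln_mono) auto
      then show ?thesis using harmonic[of J] unfolding Suc by linarith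
    qed
  qed simp
  finally show ?thesis by simp
qed

section \<open>Visits to the line\<close>

text \<open>In the rotated coordinates \<open>u, v\<close> the line is \<open>(a1 + a2) u + (a1 - a2) v = 0\<close>. One of the two
  coefficients is nonzero, so one coordinate determines the other, which then has to hit a single
  prescribed value.\<close>

lemma prb_lattice_line_le:
  assumes "a1 \<noteq> 0 \<or> a2 \<noteq> 0" "n > 0"
  shows "prb n (\<lambda>w. sum_list w \<in> lattice_line a1 a2) \<le> 1 / sqrt (real n)"
proof -
  have fiber: "avg1 n (\<lambda>u. of_bool (a * u + b = 0)) \<le> 1 / sqrt (real n)" if "a \<noteq> 0" for a b
  proof (cases "\<exists>c. a * c + b = 0")
    case True
    then obtain c where c: "a * c + b = 0" ..
    then have "a * u + b = 0 \<longleftrightarrow> u = c" for u using that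
      by (metis add_right_cancel mult_left_cancel)
    then show ?thesis using kernel1_le[OF assms(2), of c] by (simp add: kernel1_def)
  qed auto
  have "prb n (\<lambda>w. sum_list w \<in> lattice_line a1 a2) = avg n (\<lambda>w. (\<lambda>u v. of_bool ((a1 + a2) * u + (a1 - a2) * v = 0))
      (fst (sum_list w) + snd (sum_list w)) (fst (sum_list w) - snd (sum_list w)))"
    unfolding prb_def
  proof (rule avg_cong)
    fix w :: "(int \<times> int) list"
    obtain x y where xy: "sum_list w = (x, y)" by (cases "sum_list w")
    have "(a1 + a2) * (x + y) + (a1 - a2) * (x - y) = 2 * (a1 * x + a2 * y)" by (simp add: algebra_simps)
    then show "of_bool (sum_list w \<in> lattice_line a1 a2) = (\<lambda>u v. of_bool ((a1 + a2) * u + (a1 - a2) * v = 0) :: real)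
      (fst (sum_list w) + snd (sum_list w)) (fst (sum_list w) - snd (sum_list w))"
      by (simp add: xy lattice_line_def)
  qed
  also have "\<dots> = avg1 n (\<lambda>u. avg1 n (\<lambda>v. of_bool ((a1 + a2) * u + (a1 - a2) * v = 0)))"
    by (rule avg_rotate)
  also have "\<dots> \<le> 1 / sqrt (real n)"
  proof (cases "a1 - a2 = 0")
    case False
    have "avg1 n (\<lambda>u. avg1 n (\<lambda>v. of_bool ((a1 + a2) * u + (a1 - a2) * v = 0))) \<le> avg1 n (\<lambda>u. 1 / sqrt (real n))"
    proof (rule avg1_mono)
      show "avg1 n (\<lambda>v. of_bool ((a1 + a2) * u + (a1 - a2) * v = 0)) \<le> 1 / sqrt (real n)" for u
        using fiber[OF False, of "(a1 + a2) * u"] by (simp only: add.commute)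
    qed
    then show ?thesis by simp
  next
    case True
    then have *: "a1 + a2 \<noteq> 0" using assms by auto
    have "avg1 n (\<lambda>v. avg1 n (\<lambda>u. of_bool ((a1 + a2) * u + (a1 - a2) * v = 0))) \<le> avg1 n (\<lambda>u. 1 / sqrt (real n))"
      using fiber[OF *] by (intro avg1_mono) simp
    then show ?thesis by (subst avg1_swap) simp
  qed
  finally show ?thesis .
qed

lemma sum_inverse_sqrt_le: "(\<Sum>t=1..n. 1 / sqrt (real t)) \<le> 2 * sqrt (real n)"
proof (induction n)
  case 0
  then show ?case by simp
next
  case (Suc n)
  have "1 \<le> 2 * (sqrt (real (Suc n)) - sqrt (real n)) * sqrt (real (Suc n))"
  proof -
    have "0 \<le> (sqrt (real (Suc n)) - sqrt (real n))\<^sup>2" by simp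
    then show ?thesis by (simp add: power2_eq_square algebra_simps)
  qed
  then have "1 / sqrt (real (Suc n)) \<le> 2 * (sqrt (real (Suc n)) - sqrt (real n))"
    by (subst pos_divide_le_eq) auto
  then show ?case using Suc.IH by simp
qed

lemma green_lattice_line_upper:
  assumes "a1 \<noteq> 0 \<or> a2 \<noteq> 0"
  shows "green (lattice_line a1 a2) n \<le> 3 * sqrt (real n + 1)"
proof -
  let ?p = "\<lambda>t. prb t (\<lambda>w. sum_list w \<in> lattice_line a1 a2)"
  have "green (lattice_line a1 a2) n = ?p 0 + (\<Sum>t=1..n. ?p t)"
    unfolding green_def by (simp add: sum.atLeast1_atMost_eq sum.atMost_shift)
  also have "\<dots> \<le> 1 + (\<Sum>t=1..n. 1 / sqrt (real t))"
    using assms by (intro add_mono sum_mono prb_lattice_line_le) auto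
  also have "\<dots> \<le> 1 + 2 * sqrt (real n)" using sum_inverse_sqrt_le[of n] by simp
  also have "\<dots> \<le> sqrt (real n + 1) + 2 * sqrt (real n + 1)" by (intro add_mono) auto
  finally show ?thesis by simp
qed

lemma avg_uminus: "avg n (\<lambda>w. f (- sum_list w)) = avg n (\<lambda>w. f (sum_list w))"
proof (induction n arbitrary: f)
  case 0
  then show ?case by simp
next
  case (Suc n)
  have *: "avg n (\<lambda>w. f (- sum_list (s # w))) = avg n (\<lambda>w. f (sum_list ((- s) # w)))" for s
    using Suc.IH[of "\<lambda>x. f (- s + x)"] by simp
  show ?case unfolding avg.simps sum_steps * by simp
qed

lemma avg_second_moment:
  fixes a1 a2 :: int
  shows "avg n (\<lambda>w. (c + real_of_int (a1 * fst (sum_list w) + a2 * snd (sum_list w)))\<^sup>2)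
    = c\<^sup>2 + real n * ((real_of_int a1)\<^sup>2 + (real_of_int a2)\<^sup>2) / 2"
proof (induction n arbitrary: c)
  case 0
  then show ?case by simp
next
  case (Suc n)
  have "avg n (\<lambda>w. (c + real_of_int (a1 * fst (sum_list (s # w)) + a2 * snd (sum_list (s # w))))\<^sup>2)
    = (c + real_of_int (a1 * fst s + a2 * snd s))\<^sup>2 + real n * ((real_of_int a1)\<^sup>2 + (real_of_int a2)\<^sup>2) / 2" for s
    using Suc.IH[of "c + real_of_int (a1 * fst s + a2 * snd s)"] by (simp add: algebra_simps)
  then show ?case by (simp only: avg.simps sum_steps) (simp add: power2_eq_square algebra_simps)
qed

text \<open>Let \<open>z = a1 x + a2 y\<close>. By symmetry of the second half of the walk, it is on the line at time \<open>2 t\<close>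
  with the probability that two independent copies of \<open>z\<close> at time \<open>t\<close> agree, which is the sum of the
  squares of the point masses of \<open>z\<close>. At least half of the mass lies within \<open>O(\<surd>t)\<close> of 0 by Chebyshev's
  inequality, so the Cauchy-Schwarz inequality bounds that sum from below by a multiple of \<open>1/\<surd>t\<close>.\<close>

lemma prb_lattice_line_even_ge:
  fixes a1 a2 :: int
  assumes A: "A = (real_of_int a1)\<^sup>2 + (real_of_int a2)\<^sup>2" and "A > 0"
  shows "1 / (4 * (2 * sqrt A + 3)) / sqrt (real t + 1) \<le> prb (2 * t) (\<lambda>w. sum_list w \<in> lattice_line a1 a2)"
proof -
  define z where "z = (\<lambda>x :: int \<times> int. a1 * fst x + a2 * snd x)"
  define q where "q = (\<lambda>j. prb t (\<lambda>w. z (sum_list w) = j))"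
  \<comment> \<open>The variance of \<open>z\<close> at time \<open>t\<close> is \<open>t A / 2\<close>, so it exceeds \<open>r\<close> in modulus with probability
    at most 1/2.\<close>
  define r where "r = max 1 \<lceil>sqrt (real t * A)\<rceil>"
  let ?Z = "{-r..r}"
  have r: "sqrt (real t * A) \<le> real_of_int r" "1 \<le> r" "real_of_int r \<le> sqrt (real t * A) + 1"
    using \<open>A > 0\<close> unfolding r_def by (auto simp: max_def; linarith)+
  have "(\<Sum>j\<in>?Z. (q j)\<^sup>2) = avg t (\<lambda>u. avg t (\<lambda>v. \<Sum>j\<in>?Z. of_bool (z (sum_list u) = j) * of_bool (z (sum_list v) = j)))"
    by (simp only: avg_sum avg_product q_def prb_def power2_eq_square)
  also have "\<dots> \<le> avg t (\<lambda>u. avg t (\<lambda>v. of_bool (z (sum_list u) = z (sum_list v))))"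
  proof (intro avg_mono)
    fix u v :: "(int \<times> int) list"
    have "(\<Sum>j\<in>?Z. of_bool (a = j) * of_bool (b = j)) \<le> (of_bool (a = b) :: real)" for a b
    proof (cases "a = b")
      case True
      then have "(\<Sum>j\<in>?Z. of_bool (a = j) * of_bool (b = j)) = (\<Sum>j\<in>?Z. of_bool (a = j) :: real)"
        by (intro sum.cong) auto
      also have "\<dots> \<le> 1" by (subst sum_of_bool_unique) auto
      finally show ?thesis using True by simp
    next
      case False
      then show ?thesis by (auto intro!: sum_nonpos)
    qed
    then show "(\<Sum>j\<in>?Z. of_bool (z (sum_list u) = j) * of_bool (z (sum_list v) = j))
      \<le> (of_bool (z (sum_list u) = z (sum_list v)) :: real)" .
  qed
  also have "\<dots> = avg t (\<lambda>u. avg t (\<lambda>v. of_bool (sum_list (u @ v) \<in> lattice_line a1 a2)))"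
  proof (rule avg_cong)
    fix u
    have "sum_list (u @ v) \<in> lattice_line a1 a2 \<longleftrightarrow> z (sum_list u) = z (- sum_list v)" for v
      unfolding lattice_line_def z_def by (auto simp: case_prod_beta algebra_simps)
    then show "avg t (\<lambda>v. of_bool (z (sum_list u) = z (sum_list v)))
      = avg t (\<lambda>v. of_bool (sum_list (u @ v) \<in> lattice_line a1 a2))"
      using avg_uminus[of t "\<lambda>x. of_bool (z (sum_list u) = z x)"] by simp
  qed
  also have "\<dots> = prb (2 * t) (\<lambda>w. sum_list w \<in> lattice_line a1 a2)"
    unfolding prb_def mult_2 avg_append ..
  finally have sq: "(\<Sum>j\<in>?Z. (q j)\<^sup>2) \<le> prb (2 * t) (\<lambda>w. sum_list w \<in> lattice_line a1 a2)" .
  have "1 / 2 \<le> (\<Sum>j\<in>?Z. q j)"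
  proof -
    have "(\<Sum>j\<in>?Z. q j) = avg t (\<lambda>w. of_bool (z (sum_list w) \<in> ?Z))"
      unfolding q_def prb_def avg_sum[symmetric] by (simp add: of_bool_def)
    also have "\<dots> \<ge> avg t (\<lambda>w. 1 - 1 / (real_of_int r)\<^sup>2 * (0 + real_of_int (z (sum_list w)))\<^sup>2)"
    proof (rule avg_mono)
      fix w
      have "1 \<le> 1 / (real_of_int r)\<^sup>2 * (real_of_int (z (sum_list w)))\<^sup>2" if "z (sum_list w) \<notin> ?Z"
      proof -
        have "r \<le> \<bar>z (sum_list w)\<bar>" using that by auto
        then have "\<bar>real_of_int r\<bar> \<le> \<bar>real_of_int (z (sum_list w))\<bar>" using r(2) by linarith
        then have "(real_of_int r)\<^sup>2 \<le> (real_of_int (z (sum_list w)))\<^sup>2" by (rule abs_le_square_iff[THEN iffD1])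
        then show ?thesis using r(2) by (simp add: field_simps)
      qed
      then show "1 - 1 / (real_of_int r)\<^sup>2 * (0 + real_of_int (z (sum_list w)))\<^sup>2 \<le> of_bool (z (sum_list w) \<in> ?Z)"
        by (cases "z (sum_list w) \<in> ?Z") auto
    qed
    also have "avg t (\<lambda>w. 1 - 1 / (real_of_int r)\<^sup>2 * (0 + real_of_int (z (sum_list w)))\<^sup>2)
      = 1 - 1 / (real_of_int r)\<^sup>2 * (real t * A / 2)"
      by (simp only: avg_diff avg_cmult avg_const avg_second_moment z_def A) simp
    also have "\<dots> \<ge> 1 / 2"
    proof -
      have "(sqrt (real t * A))\<^sup>2 \<le> (real_of_int r)\<^sup>2"
        using r \<open>A > 0\<close> by (intro power_mono) auto
      then have "real t * A \<le> (real_of_int r)\<^sup>2" using \<open>A > 0\<close> by simp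
      then show ?thesis using r(2) by (simp add: field_simps)
    qed
    finally show ?thesis by simp
  qed
  then have "(1 / 2)\<^sup>2 \<le> (\<Sum>j\<in>?Z. q j)\<^sup>2" by (intro power_mono) auto
  also have "\<dots> \<le> (\<Sum>j\<in>?Z. (q j)\<^sup>2) * real (card ?Z)" by (rule sum_squared_le_sum_of_squares)
  also have "\<dots> \<le> prb (2 * t) (\<lambda>w. sum_list w \<in> lattice_line a1 a2) * ((2 * sqrt A + 3) * sqrt (real t + 1))"
  proof (rule mult_mono[OF sq])
    have "real (card ?Z) = 2 * real_of_int r + 1" using r(2) by simp
    also have "\<dots> \<le> 2 * (sqrt (real t) * sqrt A) + 3" using r(3) by (simp add: real_sqrt_mult)
    also have "\<dots> \<le> 2 * (sqrt (real t + 1) * sqrt A) + 3 * sqrt (real t + 1)"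
      using \<open>A > 0\<close> by (intro add_mono mult_mono) auto
    finally show "real (card ?Z) \<le> (2 * sqrt A + 3) * sqrt (real t + 1)" by (simp add: algebra_simps)
  qed auto
  finally have "1 / 4 \<le> prb (2 * t) (\<lambda>w. sum_list w \<in> lattice_line a1 a2) * ((2 * sqrt A + 3) * sqrt (real t + 1))"
    by (simp add: power2_eq_square)
  moreover have "0 < (2 * sqrt A + 3) * sqrt (real t + 1)"
    using \<open>A > 0\<close> by (intro mult_pos_pos add_nonneg_pos) auto
  ultimately show ?thesis by (simp add: field_simps)
qed

lemma green_lattice_line_lower:
  assumes "a1 \<noteq> 0 \<or> a2 \<noteq> 0"
  obtains c where "c > 0" "\<And>n. c * sqrt (real n + 1) \<le> green (lattice_line a1 a2) n"
proof -
  define A where "A = (real_of_int a1)\<^sup>2 + (real_of_int a2)\<^sup>2"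
  have "A > 0" using assms unfolding A_def by (auto intro: add_pos_nonneg add_nonneg_pos)
  define c where "c = 1 / (4 * (2 * sqrt A + 3))"
  have "c > 0" using \<open>A > 0\<close> unfolding c_def by (auto intro: add_nonneg_pos)
  let ?p = "\<lambda>t. prb t (\<lambda>w. sum_list w \<in> lattice_line a1 a2)"
  have "c / 2 * sqrt (real n + 1) \<le> green (lattice_line a1 a2) n" for n
  proof -
    have "c / 2 * sqrt (real n + 1) = (real n + 1) / 2 * (c / sqrt (real n + 1))"
      by (simp add: field_simps)
    also have "\<dots> \<le> real (n div 2 + 1) * (c / sqrt (real n + 1))"
    proof (rule mult_right_mono)
      have "n + 1 \<le> 2 * (n div 2 + 1)" by presburger
      then have "real (n + 1) \<le> real (2 * (n div 2 + 1))" by (rule of_nat_mono)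
      then show "(real n + 1) / 2 \<le> real (n div 2 + 1)" by simp
    qed (use \<open>c > 0\<close> in simp)
    also have "\<dots> = (\<Sum>t\<le>n div 2. c / sqrt (real n + 1))" by simp
    also have "\<dots> \<le> (\<Sum>t\<le>n div 2. ?p (2 * t))"
    proof (rule sum_mono)
      fix t assume "t \<in> {..n div 2}"
      then have "c / sqrt (real n + 1) \<le> c / sqrt (real t + 1)"
        using \<open>c > 0\<close> by (intro divide_left_mono) auto
      also have "\<dots> \<le> ?p (2 * t)"
        unfolding c_def by (rule prb_lattice_line_even_ge[OF A_def \<open>A > 0\<close>])
      finally show "c / sqrt (real n + 1) \<le> ?p (2 * t)" .
    qed
    also have "\<dots> = sum ?p ((\<lambda>t. 2 * t) ` {..n div 2})"
      by (subst sum.reindex) (auto simp: inj_on_def)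
    also have "\<dots> \<le> green (lattice_line a1 a2) n"
      unfolding green_def by (rule sum_mono2) auto
    finally show ?thesis .
  qed
  then show ?thesis using that[of "c / 2"] \<open>c > 0\<close> by auto
qed

section \<open>Many returns to the starting point\<close>

definition visits :: "int \<times> int \<Rightarrow> (int \<times> int) list \<Rightarrow> nat" where
  "visits x w = card {t. 0 < t \<and> t \<le> length w \<and> sum_list (take t w) = x}"

lemma visits_append: "visits y (u @ v) = visits y u + visits (y - sum_list u) v"
proof -
  let ?S = "\<lambda>w t. sum_list (take t w)"
  let ?U = "{t. 0 < t \<and> t \<le> length u \<and> ?S u t = y}"
  let ?V = "{t. 0 < t \<and> t \<le> length v \<and> ?S v t = y - sum_list u}"
  have eq: "?S (u @ v) (length u + t) = y \<longleftrightarrow> ?S v t = y - sum_list u" for t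
    by (simp add: eq_diff_eq add.commute)
  have "{t. 0 < t \<and> t \<le> length (u @ v) \<and> ?S (u @ v) t = y} = ?U \<union> (+) (length u) ` ?V"
  proof (intro set_eqI iffI)
    fix t assume t: "t \<in> {t. 0 < t \<and> t \<le> length (u @ v) \<and> ?S (u @ v) t = y}"
    show "t \<in> ?U \<union> (+) (length u) ` ?V"
    proof (cases "t \<le> length u")
      case True
      then show ?thesis using t by simp
    next
      case False
      then obtain j where "t = length u + j" "j > 0" by (metis less_imp_add_positive not_le)
      then show ?thesis using t eq[of j] by auto
    qed
  next
    fix t assume "t \<in> ?U \<union> (+) (length u) ` ?V"
    then show "t \<in> {t. 0 < t \<and> t \<le> length (u @ v) \<and> ?S (u @ v) t = y}"
      using eq by auto
  qed
  then have "visits y (u @ v) = card (?U \<union> (+) (length u) ` ?V)" by (simp add: visits_def)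
  also have "\<dots> = card ?U + card ((+) (length u) ` ?V)"
    by (rule card_Un_disjoint) auto
  also have "card ((+) (length u) ` ?V) = card ?V" by (rule card_image) simp
  finally show ?thesis by (simp add: visits_def)
qed

lemma visits_take_drop:
  "visits y w = visits y (take t w) + visits (y - sum_list (take t w)) (drop t w)"
  using visits_append[of y "take t w" "drop t w"] by simp

lemma visits_take_le: "visits y (take t w) \<le> visits y w"
  using visits_take_drop[of y w t] by simp

lemma visits_endpoint_pos:
  assumes "u \<noteq> []" shows "visits (sum_list u) u \<ge> 1"
proof -
  have "card {length u} \<le> visits (sum_list u) u"
    unfolding visits_def using assms by (intro card_mono) auto
  then show ?thesis by simp
qed

lemma visits_Nil [simp]: "visits y [] = 0"
proof -
  have "{t. 0 < t \<and> t \<le> length [] \<and> sum_list (take t []) = y} = {}" by auto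
  then show ?thesis unfolding visits_def by (metis card.empty)
qed

lemma visits_Cons: "visits y (a # w) = of_bool (a = y) + visits (y - a) w"
proof -
  have "{t. 0 < t \<and> t \<le> length [a] \<and> sum_list (take t [a]) = y} = (if a = y then {1} else {})"
    by (auto simp: le_Suc_eq)
  then have "visits y [a] = of_bool (a = y)" by (simp add: visits_def)
  then show ?thesis using visits_append[of y "[a]" w] by simp
qed

definition hits_first :: "(int \<times> int) set \<Rightarrow> nat \<Rightarrow> (int \<times> int) list \<Rightarrow> bool" where
  "hits_first K c u \<longleftrightarrow> c < length u \<and> sum_list u \<in> K
    \<and> (\<forall>j. c < j \<and> j < length u \<longrightarrow> sum_list (take j u) \<notin> K)"

lemma sum_hits_first:
  assumes "length w = n"
  shows "(\<Sum>t\<le>n. of_bool (hits_first K c (take t w))) = (of_bool (\<not> avoids K c w) :: real)"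
proof -
  let ?H = "\<lambda>t. hits_first K c (take t w)"
  have *: "?H t \<longleftrightarrow> c < t \<and> sum_list (take t w) \<in> K \<and> (\<forall>j. c < j \<and> j < t \<longrightarrow> sum_list (take j w) \<notin> K)"
    if "t \<le> n" for t
    using that assms unfolding hits_first_def by (auto simp: min_def)
  have "(\<exists>t\<in>{..n}. ?H t) \<longleftrightarrow> \<not> avoids K c w"
  proof
    assume "\<not> avoids K c w"
    then have ex: "\<exists>t. c < t \<and> t \<le> n \<and> sum_list (take t w) \<in> K"
      using assms by (auto simp: avoids_def)
    define t where "t = (LEAST t. c < t \<and> t \<le> n \<and> sum_list (take t w) \<in> K)"
    have t: "c < t \<and> t \<le> n \<and> sum_list (take t w) \<in> K" unfolding t_def by (rule LeastI_ex[OF ex])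
    moreover have "sum_list (take j w) \<notin> K" if "c < j" "j < t" for j
      using not_less_Least[of j "\<lambda>t. c < t \<and> t \<le> n \<and> sum_list (take t w) \<in> K"] that t
      unfolding t_def[symmetric] by auto
    ultimately show "\<exists>t\<in>{..n}. ?H t" using *[of t] by auto
  next
    assume "\<exists>t\<in>{..n}. ?H t"
    then show "\<not> avoids K c w" using * assms by (auto simp: avoids_def)
  qed
  moreover have "s = t" if "s \<in> {..n}" "t \<in> {..n}" "?H s" "?H t" for s t
    using that * by (metis atMost_iff linorder_neqE_nat)
  ultimately show ?thesis
    using sum_of_bool_unique[of "{..n}" ?H] by auto
qed

text \<open>If the first \<open>k\<close> successive return times are all at most \<open>m\<close>, there are \<open>k\<close> returns by time \<open>k m\<close>.
  The induction splits the word at the first return.\<close>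

lemma prb_many_returns_ge: "(1 - escape {0} m) ^ k \<le> prb (k * m) (\<lambda>w. k \<le> visits 0 w)"
proof (induction k)
  case 0
  then show ?case by simp
next
  case (Suc k)
  let ?H = "\<lambda>u. of_bool (hits_first {0} 0 u) :: real"
  let ?R = "\<lambda>v. of_bool (k \<le> visits 0 v) :: real"
  let ?n = "Suc k * m"
  have "(1 - escape {0} m) * prb (k * m) (\<lambda>w. k \<le> visits 0 w)
    = (\<Sum>t\<le>m. avg t ?H) * prb (k * m) (\<lambda>w. k \<le> visits 0 w)"
  proof -
    have "(\<Sum>t\<le>m. avg t ?H) = (\<Sum>t\<le>m. avg m (\<lambda>w. ?H (take t w)))"
      by (intro sum.cong refl avg_take[symmetric]) auto
    also have "\<dots> = avg m (\<lambda>w. \<Sum>t\<le>m. ?H (take t w))" by (simp only: avg_sum)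
    also have "\<dots> = prb m (\<lambda>w. \<not> avoids {0} 0 w)"
      unfolding prb_def by (intro avg_cong sum_hits_first)
    finally show ?thesis by (simp add: prb_not escape_def)
  qed
  also have "\<dots> \<le> (\<Sum>t\<le>m. avg t ?H * avg (?n - t) ?R)"
    unfolding sum_distrib_right
  proof (rule sum_mono)
    fix t assume "t \<in> {..m}"
    then have "prb (k * m) (\<lambda>w. k \<le> visits 0 w) \<le> prb (?n - t) (\<lambda>w. k \<le> visits 0 w)"
      by (intro prb_take_mono) (auto intro: order_trans[OF _ visits_take_le])
    then show "avg t ?H * prb (k * m) (\<lambda>w. k \<le> visits 0 w) \<le> avg t ?H * avg (?n - t) ?R"
      unfolding prb_def by (intro mult_left_mono avg_nonneg) auto
  qed
  also have "\<dots> = avg ?n (\<lambda>w. \<Sum>t\<le>m. ?H (take t w) * ?R (drop t w))"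
    unfolding avg_sum by (intro sum.cong refl avg_split[symmetric]) auto
  also have "\<dots> \<le> prb ?n (\<lambda>w. Suc k \<le> visits 0 w)"
    unfolding prb_def
  proof (rule avg_mono)
    fix w :: "(int \<times> int) list" assume w: "length w = ?n"
    show "(\<Sum>t\<le>m. ?H (take t w) * ?R (drop t w)) \<le> of_bool (Suc k \<le> visits 0 w)"
    proof (cases "Suc k \<le> visits 0 w")
      case True
      have "(\<Sum>t\<le>m. ?H (take t w) * ?R (drop t w)) \<le> (\<Sum>t\<le>?n. ?H (take t w))"
        by (rule order_trans[OF sum_mono sum_mono2]) auto
      also have "\<dots> \<le> 1" unfolding sum_hits_first[OF w] by simp
      finally show ?thesis using True by simp
    next
      case False
      have "?H (take t w) * ?R (drop t w) = 0" for t
      proof (cases "hits_first {0} 0 (take t w)")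
        case True
        then have "sum_list (take t w) = 0" "take t w \<noteq> []" by (auto simp: hits_first_def)
        then have "\<not> k \<le> visits 0 (drop t w)"
          using visits_take_drop[of 0 w t] visits_endpoint_pos[of "take t w"] False by simp
        then show ?thesis by simp
      qed simp
      then show ?thesis by simp
    qed
  qed
  finally have "(1 - escape {0} m) * prb (k * m) (\<lambda>w. k \<le> visits 0 w) \<le> prb ?n (\<lambda>w. Suc k \<le> visits 0 w)" .
  moreover have "(1 - escape {0} m) ^ Suc k \<le> (1 - escape {0} m) * prb (k * m) (\<lambda>w. k \<le> visits 0 w)"
    using Suc.IH by (auto intro: mult_left_mono simp: escape_def)
  ultimately show ?case by linarith
qed

lemma prb_many_returns_ge_green:
  assumes "k * m \<le> b"
  shows "(1 - 1 / green {0} m) ^ k \<le> prb b (\<lambda>w. k \<le> visits 0 w)"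
proof -
  have "(1 - 1 / green {0} m) ^ k \<le> (1 - escape {0} m) ^ k"
    using green_pos[OF additive_subgroup_zero, of m] escape_le_inverse_green[OF additive_subgroup_zero, of m]
    by (intro power_mono) (auto simp: field_simps)
  also have "\<dots> \<le> prb (k * m) (\<lambda>w. k \<le> visits 0 w)" by (rule prb_many_returns_ge)
  also have "\<dots> \<le> prb b (\<lambda>w. k \<le> visits 0 w)"
    using assms by (intro prb_take_mono) (auto intro: order_trans[OF _ visits_take_le])
  finally show ?thesis .
qed

section \<open>Repeated attempts from the subgroup\<close>

definition quiet :: "(int \<times> int) set \<Rightarrow> nat \<Rightarrow> (int \<times> int) list \<Rightarrow> bool" where
  "quiet K k w \<longleftrightarrow> (\<forall>x\<in>K. visits x w < k)"

lemma quiet_take: "quiet K k w \<Longrightarrow> quiet K k (take t w)"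
  unfolding quiet_def by (meson le_less_trans visits_take_le)

lemma quiet_drop:
  assumes "additive_subgroup K" "quiet K k w" "sum_list (take t w) \<in> K"
  shows "quiet K k (drop t w)"
  unfolding quiet_def
proof
  fix x assume "x \<in> K"
  then have "sum_list (take t w) + x \<in> K"
    using assms unfolding additive_subgroup_def by blast
  then have "visits (sum_list (take t w) + x) w < k" using assms(2) by (simp add: quiet_def)
  then show "visits x (drop t w) < k"
    using visits_take_drop[of "sum_list (take t w) + x" w t] by simp
qed

lemma prb_quiet_antimono: "m \<le> n \<Longrightarrow> prb n (quiet K k) \<le> prb m (quiet K k)"
proof -
  assume "m \<le> n"
  then have "prb m (\<lambda>w. \<not> quiet K k w) \<le> prb n (\<lambda>w. \<not> quiet K k w)"
    by (intro prb_take_mono) (auto dest: quiet_take)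
  then show ?thesis by (simp add: prb_not)
qed

text \<open>The event that a renewal takes place at the end of the word \<open>u\<close>. It looks at nothing beyond \<open>u\<close>, so
  in a longer word it is independent of what follows \<open>u\<close>.\<close>

definition failed_attempt :: "(int \<times> int) set \<Rightarrow> nat \<Rightarrow> nat \<Rightarrow> (int \<times> int) list \<Rightarrow> bool" where
  "failed_attempt K k b u \<longleftrightarrow> hits_first K b u \<and> visits 0 (take b u) < k"

text \<open>A quiet word fails its first attempt, and it remains quiet after the next visit to \<open>K\<close>, where a
  new attempt begins, unless that visit does not come in time.\<close>

lemma prb_quiet_renewal:
  assumes "additive_subgroup K"
  shows "prb n (quiet K k)
    \<le> (\<Sum>t\<le>n. prb t (failed_attempt K k b) * prb (n - t) (quiet K k)) + prb n (avoids K b)"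
proof -
  let ?F = "\<lambda>u. of_bool (failed_attempt K k b u) :: real"
  let ?Q = "\<lambda>v. of_bool (quiet K k v) :: real"
  have "prb n (quiet K k) \<le> avg n (\<lambda>w. (\<Sum>t\<le>n. ?F (take t w) * ?Q (drop t w)) + of_bool (avoids K b w))"
    unfolding prb_def
  proof (rule avg_mono)
    fix w :: "(int \<times> int) list" assume w: "length w = n"
    show "?Q w \<le> (\<Sum>t\<le>n. ?F (take t w) * ?Q (drop t w)) + of_bool (avoids K b w)"
    proof (cases "quiet K k w \<and> \<not> avoids K b w")
      case True
      then have q: "quiet K k w" and sum1: "(\<Sum>t\<le>n. of_bool (hits_first K b (take t w))) = (1::real)"
        using sum_hits_first[OF w, of K b] by auto
      have "\<exists>t\<le>n. hits_first K b (take t w)"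
      proof (rule ccontr)
        assume "\<not> ?thesis"
        then have "(\<Sum>t\<le>n. of_bool (hits_first K b (take t w))) = (0::real)" by (intro sum.neutral) auto
        then show False using sum1 by simp
      qed
      then obtain t where t: "t \<le> n" "hits_first K b (take t w)" by blast
      have "b < t" "sum_list (take t w) \<in> K" using t by (auto simp: hits_first_def)
      moreover have "visits 0 (take b w) < k"
        using q assms visits_take_le[of 0 b w] by (auto simp: quiet_def additive_subgroup_def intro: le_less_trans)
      ultimately have "failed_attempt K k b (take t w)" "quiet K k (drop t w)"
        using t quiet_drop[OF assms q] by (auto simp: failed_attempt_def min_def)
      then have "1 = ?F (take t w) * ?Q (drop t w)" by simp
      also have "\<dots> \<le> (\<Sum>t\<le>n. ?F (take t w) * ?Q (drop t w))"
        using t by (intro member_le_sum) auto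
      finally show ?thesis using True by simp
    next
      case False
      have "0 \<le> (\<Sum>t\<le>n. ?F (take t w) * ?Q (drop t w))" by (intro sum_nonneg) auto
      then show ?thesis using False by (auto simp: of_bool_def)
    qed
  qed
  also have "\<dots> = (\<Sum>t\<le>n. prb t (failed_attempt K k b) * prb (n - t) (quiet K k)) + prb n (avoids K b)"
    unfolding avg_add avg_sum prb_def by (intro arg_cong2[of _ _ _ _ "(+)"] sum.cong refl avg_split) auto
  finally show ?thesis .
qed

lemma sum_prb_failed_attempt_le:
  assumes "b \<le> N"
  shows "(\<Sum>t\<le>N. prb t (failed_attempt K k b)) \<le> 1 - prb b (\<lambda>w. k \<le> visits 0 w)"
proof -
  let ?F = "\<lambda>u. of_bool (failed_attempt K k b u) :: real"
  have "(\<Sum>t\<le>N. prb t (failed_attempt K k b)) = (\<Sum>t\<le>N. avg N (\<lambda>w. ?F (take t w)))"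
    unfolding prb_def by (intro sum.cong refl avg_take[symmetric]) auto
  also have "\<dots> = avg N (\<lambda>w. \<Sum>t\<le>N. ?F (take t w))" by (simp only: avg_sum)
  also have "\<dots> \<le> avg N (\<lambda>w. of_bool (\<not> k \<le> visits 0 (take b w)))"
  proof (rule avg_mono)
    fix w :: "(int \<times> int) list" assume w: "length w = N"
    have eq: "failed_attempt K k b (take t w) \<longleftrightarrow> hits_first K b (take t w) \<and> \<not> k \<le> visits 0 (take b w)" for t
      unfolding failed_attempt_def hits_first_def by (auto simp: min_def split: if_splits)
    show "(\<Sum>t\<le>N. ?F (take t w)) \<le> of_bool (\<not> k \<le> visits 0 (take b w))"
      using sum_hits_first[OF w, of K b] by (simp add: eq)
  qed
  also have "\<dots> = prb b (\<lambda>w. \<not> k \<le> visits 0 w)"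
    unfolding prb_def using assms by (rule avg_take)
  finally show ?thesis by (simp add: prb_not)
qed

text \<open>Summing the renewal inequality over \<open>n \<le> N\<close> bounds the convolution by a product, in which the total mass of the
  failed attempts is at most \<open>1 - p\<close>, where \<open>p\<close> is the probability of success of one attempt. What
  remains is \<open>p\<close> times the sum of the quiet probabilities, and these decrease in \<open>n\<close>.\<close>

lemma prb_quiet_le:
  assumes "additive_subgroup K" "b \<le> N"
  shows "(real N + 1) * prb N (quiet K k) * prb b (\<lambda>w. k \<le> visits 0 w) \<le> (\<Sum>n\<le>N. prb n (avoids K b))"
proof -
  let ?\<phi> = "\<lambda>t. prb t (failed_attempt K k b)" and ?q = "\<lambda>n. prb n (quiet K k)"
  let ?p = "prb b (\<lambda>w. k \<le> visits 0 w)"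
  let ?Q = "\<Sum>n\<le>N. ?q n"
  have "?Q \<le> (\<Sum>n\<le>N. \<Sum>t\<le>n. ?\<phi> t * ?q (n - t)) + (\<Sum>n\<le>N. prb n (avoids K b))"
    unfolding sum.distrib[symmetric] by (intro sum_mono prb_quiet_renewal assms)
  also have "(\<Sum>n\<le>N. \<Sum>t\<le>n. ?\<phi> t * ?q (n - t)) = (\<Sum>(i, j)\<in>{(i, j). i + j \<le> N}. ?\<phi> i * ?q j)"
    by (rule sum.triangle_reindex_eq[symmetric])
  also have "\<dots> \<le> (\<Sum>(i, j)\<in>{..N} \<times> {..N}. ?\<phi> i * ?q j)"
    by (rule sum_mono2) auto
  also have "\<dots> = (\<Sum>t\<le>N. ?\<phi> t) * ?Q" by (simp only: sum_product sum.cartesian_product)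
  also have "\<dots> \<le> (1 - ?p) * ?Q"
    by (intro mult_right_mono sum_prb_failed_attempt_le assms sum_nonneg) auto
  finally have "?Q * ?p \<le> (\<Sum>n\<le>N. prb n (avoids K b))" by (simp add: algebra_simps)
  moreover have "(real N + 1) * ?q N \<le> ?Q"
    using sum_bounded_below[of "{..N}" "?q N" ?q] prb_quiet_antimono[of _ N K k] by (simp add: algebra_simps)
  then have "(real N + 1) * ?q N * ?p \<le> ?Q * ?p" by (rule mult_right_mono) simp
  ultimately show ?thesis by linarith
qed

section \<open>Exponential moments of the local times\<close>

text \<open>Each visit to \<open>x\<close> multiplies the power by \<open>1 + s\<close>; telescoping from the last visit backwards leaves
  one term for each visit, containing only the visits after it. Unlike the left-hand side, the terms
  for different \<open>x\<close> have the same form, so they can be summed over all points \<open>x\<close> of a set at once.\<close>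

lemma visits_power_telescope:
  fixes s :: real
  shows "(1 + s) ^ visits x w - 1
    = (\<Sum>t=1..length w. of_bool (sum_list (take t w) = x) * (s * (1 + s) ^ visits 0 (drop t w)))"
proof (induction w arbitrary: x)
  case Nil
  then show ?case by simp
next
  case (Cons a w)
  have "(\<Sum>t=1..length (a # w). of_bool (sum_list (take t (a # w)) = x) * (s * (1 + s) ^ visits 0 (drop t (a # w))))
    = of_bool (a = x) * (s * (1 + s) ^ visits 0 w) + (\<Sum>t=1..length w. of_bool (sum_list (take t w) = x - a) * (s * (1 + s) ^ visits 0 (drop t w)))"
    unfolding One_nat_def sum.atLeast1_atMost_eq length_Cons sum.lessThan_Suc_shift
    by (simp add: eq_diff_eq add.commute del: sum.lessThan_Suc)
  also have "\<dots> = of_bool (a = x) * (s * (1 + s) ^ visits 0 w) + ((1 + s) ^ visits (x - a) w - 1)"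
    by (simp only: Cons.IH)
  also have "\<dots> = (1 + s) ^ visits x (a # w) - 1"
    by (simp add: visits_Cons algebra_simps)
  finally show ?case by simp
qed

lemma avg_visits_sum:
  fixes s :: real
  assumes "s \<ge> 0" "0 \<in> K"
  shows "avg n (\<lambda>w. \<Sum>t=1..n. of_bool (sum_list (take t w) \<in> K) * (s * (1 + s) ^ visits 0 (drop t w)))
    \<le> (green K n - 1) * (s * avg n (\<lambda>w. (1 + s) ^ visits 0 w))"
proof -
  have mono: "avg (n - t) (\<lambda>w. (1 + s) ^ visits 0 w) \<le> avg n (\<lambda>w. (1 + s) ^ visits 0 w)" for t
  proof -
    have "avg (n - t) (\<lambda>w. (1 + s) ^ visits 0 w) = avg n (\<lambda>w. (1 + s) ^ visits 0 (take (n - t) w))"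
      by (rule avg_take[symmetric]) simp
    also have "\<dots> \<le> avg n (\<lambda>w. (1 + s) ^ visits 0 w)"
      using assms by (intro avg_mono power_increasing visits_take_le) auto
    finally show ?thesis .
  qed
  have "avg n (\<lambda>w. \<Sum>t=1..n. of_bool (sum_list (take t w) \<in> K) * (s * (1 + s) ^ visits 0 (drop t w)))
    = (\<Sum>t=1..n. prb t (\<lambda>w. sum_list w \<in> K) * (s * avg (n - t) (\<lambda>w. (1 + s) ^ visits 0 w)))"
    unfolding avg_sum prb_def
    by (intro sum.cong refl, subst avg_split[of _ n "\<lambda>u. of_bool (sum_list u \<in> K)"
        "\<lambda>v. s * (1 + s) ^ visits 0 v"]) (auto simp: avg_cmult)
  also have "\<dots> \<le> (\<Sum>t=1..n. prb t (\<lambda>w. sum_list w \<in> K)) * (s * avg n (\<lambda>w. (1 + s) ^ visits 0 w))"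
    unfolding sum_distrib_right using assms by (intro sum_mono mult_left_mono mono) auto
  also have "(\<Sum>t=1..n. prb t (\<lambda>w. sum_list w \<in> K)) = green K n - 1"
    using assms(2) unfolding green_def
    by (simp add: sum.atLeast1_atMost_eq sum.atMost_shift prb_def[of 0])
  finally show ?thesis .
qed

text \<open>By the telescoping formula the moment \<open>h\<close> satisfies \<open>h \<le> 1 + s (G - 1) h\<close>, where \<open>G - 1\<close> is the
  expected number of returns. The bound is the probability generating function at \<open>1 + s\<close> of a
  geometric variable with mean \<open>G - 1\<close>.\<close>

lemma avg_power_visits_le:
  fixes s :: real
  assumes "s \<ge> 0" "s * (green {0} n - 1) < 1"
  shows "avg n (\<lambda>w. (1 + s) ^ visits 0 w) \<le> 1 / (1 - s * (green {0} n - 1))"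
proof -
  let ?h = "avg n (\<lambda>w. (1 + s) ^ visits 0 w)"
  have "?h - 1 = avg n (\<lambda>w. (1 + s) ^ visits 0 w - 1)" by (simp add: avg_diff)
  also have "\<dots> = avg n (\<lambda>w. \<Sum>t=1..n. of_bool (sum_list (take t w) \<in> {0}) * (s * (1 + s) ^ visits 0 (drop t w)))"
    by (rule avg_cong) (simp add: visits_power_telescope)
  also have "\<dots> \<le> (green {0} n - 1) * (s * ?h)" using assms(1) by (intro avg_visits_sum) auto
  finally have "?h * (1 - s * (green {0} n - 1)) \<le> 1" by (simp add: algebra_simps)
  then show ?thesis using assms(2) by (simp add: pos_le_divide_eq)
qed

text \<open>Markov's inequality for the sum of the telescoped terms over all visits to \<open>K\<close>. Its mean is at most
  the expected number of visits to \<open>K\<close> times the moment for a single point.\<close>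

lemma prb_not_quiet_le:
  fixes s :: real
  assumes "s > 0" "s * (green {0} n - 1) < 1" "additive_subgroup K"
  shows "prb n (\<lambda>w. \<not> quiet K k w) * ((1 + s) ^ k - 1) \<le> s * green K n / (1 - s * (green {0} n - 1))"
proof -
  have "prb n (\<lambda>w. \<not> quiet K k w) * ((1 + s) ^ k - 1) = avg n (\<lambda>w. ((1 + s) ^ k - 1) * of_bool (\<not> quiet K k w))"
    unfolding prb_def avg_cmult by simp
  also have "\<dots> \<le> avg n (\<lambda>w. \<Sum>t=1..n. of_bool (sum_list (take t w) \<in> K) * (s * (1 + s) ^ visits 0 (drop t w)))"
  proof (rule avg_mono)
    fix w :: "(int \<times> int) list" assume w: "length w = n"
    let ?\<Phi> = "\<lambda>A. \<Sum>t=1..n. of_bool (A (sum_list (take t w))) * (s * (1 + s) ^ visits 0 (drop t w))"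
    have "0 \<le> ?\<Phi> (\<lambda>x. x \<in> K)" using assms by (intro sum_nonneg) auto
    moreover have "(1 + s) ^ k - 1 \<le> ?\<Phi> (\<lambda>x. x \<in> K)" if loud: "\<not> quiet K k w"
    proof -
      obtain x where x: "x \<in> K" "k \<le> visits x w" using loud unfolding quiet_def by (metis not_less)
      have "(1 + s) ^ k - 1 \<le> (1 + s) ^ visits x w - 1"
        using x assms by (intro diff_right_mono power_increasing) auto
      also have "\<dots> = ?\<Phi> (\<lambda>y. y = x)" unfolding visits_power_telescope w ..
      also have "\<dots> \<le> ?\<Phi> (\<lambda>x. x \<in> K)"
        using x assms by (intro sum_mono mult_right_mono) (auto simp: of_bool_def)
      finally show ?thesis .
    qed
    ultimately show "((1 + s) ^ k - 1) * of_bool (\<not> quiet K k w) \<le> ?\<Phi> (\<lambda>x. x \<in> K)"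
      by (cases "quiet K k w") auto
  qed
  also have "\<dots> \<le> (green K n - 1) * (s * avg n (\<lambda>w. (1 + s) ^ visits 0 w))"
    using assms by (intro avg_visits_sum) (auto simp: additive_subgroup_def)
  also have "\<dots> \<le> green K n * (s * (1 / (1 - s * (green {0} n - 1))))"
    using assms green_pos[OF assms(3), of n]
    by (intro mult_mono avg_power_visits_le mult_nonneg_nonneg avg_nonneg) auto
  finally show ?thesis by (simp add: mult_ac)
qed

section \<open>Summability along powers of two\<close>

lemma summable_exp_decay:
  fixes p :: "nat \<Rightarrow> real"
  assumes "\<And>j. 0 \<le> p j" "\<delta> > 0" "\<forall>\<^sub>F j in sequentially. p j \<le> C * exp (- \<delta> * (real j * ln 2))"
  shows "summable p"
proof (rule summable_comparison_test_ev)
  have "exp (- \<delta> * ln 2) < 1" using assms(2) by simp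
  then have "summable (\<lambda>j. exp (- \<delta> * ln 2) ^ j)" by (intro summable_geometric) simp
  then have *: "summable (\<lambda>j. C * exp (- \<delta> * ln 2) ^ j)" by (rule summable_mult)
  have eq: "exp (- \<delta> * ln 2) ^ j = exp (- \<delta> * (real j * ln 2))" for j
    by (simp add: exp_of_nat_mult[symmetric] mult_ac)
  show "summable (\<lambda>j. C * exp (- \<delta> * (real j * ln 2)))" using * unfolding eq .
  show "\<forall>\<^sub>F j in sequentially. norm (p j) \<le> C * exp (- \<delta> * (real j * ln 2))"
    using assms(3) by eventually_elim (simp add: assms(1))
qed

lemma sqrt_two_power: "sqrt (2 ^ j) = exp (1 / 2 * (real j * ln 2))"
proof -
  have "(2::real) ^ j = exp (1 / 2 * (real j * ln 2)) ^ 2"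
    by (simp add: exp_of_nat_mult exp_double[symmetric])
  then show ?thesis by simp
qed

definition threshold :: "real \<Rightarrow> nat \<Rightarrow> nat" where
  "threshold a j = nat \<lceil>a * (real j * ln 2)\<^sup>2\<rceil>"

lemma threshold_ge: "a * (real j * ln 2)\<^sup>2 \<le> real (threshold a j)"
  unfolding threshold_def by linarith

lemma threshold_le: "a \<ge> 0 \<Longrightarrow> real (threshold a j) \<le> a * (real j * ln 2)\<^sup>2 + 1"
proof -
  assume "a \<ge> 0"
  then have "0 \<le> a * (real j * ln 2)\<^sup>2" by simp
  then show ?thesis unfolding threshold_def by linarith
qed

lemma threshold_pos: "a > 0 \<Longrightarrow> j > 0 \<Longrightarrow> threshold a j > 0"
  by (simp add: threshold_def)

lemma exp_le_one_plus_power: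
  fixes s :: real
  assumes "s > 0" shows "exp (real k * (s / (1 + s))) \<le> (1 + s) ^ k"
proof -
  have "ln (1 / (1 + s)) \<le> 1 / (1 + s) - 1" using assms by (intro ln_le_minus_one) simp
  then have "s / (1 + s) \<le> ln (1 + s)" using assms by (simp add: ln_div field_simps)
  then have "exp (s / (1 + s)) \<le> 1 + s" using assms by (metis add_pos_pos exp_le_cancel_iff exp_ln zero_less_one)
  then have "exp (s / (1 + s)) ^ k \<le> (1 + s) ^ k" by (intro power_mono) auto
  then show ?thesis by (simp add: exp_of_nat_mult[symmetric])
qed

lemma exp_le_one_minus_power:
  fixes G :: real
  assumes "G > 1" shows "exp (- (real k / (G - 1))) \<le> (1 - 1 / G) ^ k"
proof -
  have "1 - 1 / G = 1 / (G / (G - 1))" using assms by (simp add: field_simps)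
  moreover have "G / (G - 1) \<le> exp (1 / (G - 1))"
    using exp_ge_add_one_self[of "1 / (G - 1)"] assms by (simp add: field_simps)
  then have "1 / exp (1 / (G - 1)) \<le> 1 / (G / (G - 1))"
    using assms by (intro divide_left_mono) auto
  ultimately have "exp (- (1 / (G - 1))) \<le> 1 - 1 / G" by (simp add: exp_minus inverse_eq_divide)
  then have "exp (- (1 / (G - 1))) ^ k \<le> (1 - 1 / G) ^ k" by (intro power_mono) auto
  then show ?thesis by (simp add: exp_of_nat_mult[symmetric])
qed

text \<open>With \<open>n = 2\<^sup>j\<close> and \<open>s = \<theta> \<pi> / (1 + log n)\<close> for a fixed \<open>\<theta> < 1\<close>, the exponential moments stay bounded
  while \<open>(1 + s)\<close> to the power \<open>a log\<^sup>2 n\<close> is about \<open>n\<close> to the power \<open>a \<theta> \<pi>\<close>. If \<open>a > 1/(2 \<pi>)\<close>, some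
  \<open>\<theta> < 1\<close> makes this exponent larger than the \<open>1/2\<close> coming from the visits to the line.\<close>

lemma summable_prb_not_quiet:
  assumes "a1 \<noteq> 0 \<or> a2 \<noteq> 0" "a > 1 / (2 * pi)"
  shows "summable (\<lambda>j. prb (2 ^ j) (\<lambda>w. \<not> quiet (lattice_line a1 a2) (threshold a j) w))"
proof -
  let ?p = "\<lambda>j. prb (2 ^ j) (\<lambda>w. \<not> quiet (lattice_line a1 a2) (threshold a j) w)"
  have a: "a > 0" by (rule less_trans[OF _ assms(2)]) simp
  have "1 / (2 * pi * a) < 1" using assms(2) a by (simp add: field_simps)
  then obtain \<theta> where \<theta>': "1 / (2 * pi * a) < \<theta>" "\<theta> < 1" using dense by blast
  have "0 < 1 / (2 * pi * a)" using a by simp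
  then have \<theta>: "0 < \<theta>" "\<theta> < 1" using \<theta>' by linarith+
  have "1 / (2 * pi * a) * (a * pi) < \<theta> * (a * pi)"
    using \<theta>' a by (intro mult_strict_right_mono) auto
  then have "1 / 2 < a * \<theta> * pi" using a by (simp add: mult_ac)
  then obtain \<beta> where \<beta>: "1 / 2 < \<beta>" "\<beta> < a * \<theta> * pi" using dense by blast
  define G where "G = (\<lambda>j. (1 + real j * ln 2) / pi)"
  have G: "G j > 0" for j unfolding G_def by (intro divide_pos_pos add_pos_nonneg) auto
  have "((\<lambda>j. a * \<theta> * pi * (real j * ln 2 / (1 + real j * ln 2 + \<theta> * pi))) \<longlongrightarrow> a * \<theta> * pi * 1) sequentially"
    by (intro tendsto_mult tendsto_const) real_asymp
  then have "\<forall>\<^sub>F j in sequentially. \<beta> < a * \<theta> * pi * (real j * ln 2 / (1 + real j * ln 2 + \<theta> * pi))"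
    using \<beta> by (intro order_tendstoD) auto
  then have "\<forall>\<^sub>F j in sequentially. ?p j \<le> 6 * sqrt 2 * pi / (1 - \<theta>) * exp (- (\<beta> - 1 / 2) * (real j * ln 2))"
    using eventually_ge_at_top[of 2]
  proof eventually_elim
    case (elim j)
    define s where "s = \<theta> / G j"
    define k where "k = threshold a j"
    have s: "s > 0" using \<theta> G[of j] by (simp add: s_def)
    have s_le: "s \<le> pi"
    proof -
      have "\<theta> \<le> 1 * (1 + real j * ln 2)" using \<theta> by (simp add: add_increasing2)
      then have "\<theta> \<le> pi * G j" by (simp add: G_def)
      then show ?thesis using G[of j] by (simp add: s_def pos_divide_le_eq)
    qed
    have "green {0} (2 ^ j) - 1 \<le> G j"
      using green_zero_upper[of "2 ^ j"] by (simp add: G_def ln_realpow)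
    then have "s * (green {0} (2 ^ j) - 1) \<le> s * G j" using s by (intro mult_left_mono) auto
    then have sg: "s * (green {0} (2 ^ j) - 1) \<le> \<theta>" using G[of j] by (simp add: s_def)
    have "\<beta> * (real j * ln 2) \<le> real k * (s / (1 + s))"
    proof -
      have "\<beta> * (real j * ln 2) \<le> a * \<theta> * pi * (real j * ln 2 / (1 + real j * ln 2 + \<theta> * pi)) * (real j * ln 2)"
        using elim(1) by (intro mult_right_mono) auto
      also have "\<dots> = a * (real j * ln 2)\<^sup>2 * (s / (1 + s))"
      proof -
        have "s / (1 + s) = \<theta> / (G j + \<theta>)" using G[of j] \<theta> by (simp add: s_def field_simps)
        also have "\<dots> = \<theta> * pi / (1 + real j * ln 2 + \<theta> * pi)"
          unfolding G_def by (simp add: field_simps)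
        finally have *: "s / (1 + s) = \<theta> * pi / (1 + real j * ln 2 + \<theta> * pi)" .
        show ?thesis unfolding * by (simp add: power2_eq_square)
      qed
      also have "\<dots> \<le> real k * (s / (1 + s))"
        unfolding k_def using s by (intro mult_right_mono threshold_ge) auto
      finally show ?thesis .
    qed
    then have big: "exp (\<beta> * (real j * ln 2)) \<le> (1 + s) ^ k"
      using exp_le_one_plus_power[OF s, of k] by (metis exp_le_cancel_iff order_trans)
    have "2 \<le> exp (\<beta> * (real j * ln 2))"
    proof -
      have "1 \<le> \<beta> * real j" using \<beta> elim(2) mult_mono[of "1/2" \<beta> 2 "real j"] by simp
      then have "1 * ln 2 \<le> (\<beta> * real j) * ln 2" by (intro mult_right_mono) auto
      then have "ln 2 \<le> \<beta> * (real j * ln 2)" by (simp only: mult.assoc mult_1)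
      then have "exp (ln 2) \<le> exp (\<beta> * (real j * ln 2))" by (simp only: exp_le_cancel_iff)
      moreover have "exp (ln 2) = (2::real)" by simp
      ultimately show ?thesis by linarith
    qed
    then have half: "exp (\<beta> * (real j * ln 2)) / 2 \<le> (1 + s) ^ k - 1" using big by linarith
    have "?p j * (exp (\<beta> * (real j * ln 2)) / 2) \<le> ?p j * ((1 + s) ^ k - 1)"
      using half by (intro mult_left_mono) auto
    also have "\<dots> \<le> s * green (lattice_line a1 a2) (2 ^ j) / (1 - s * (green {0} (2 ^ j) - 1))"
      unfolding k_def[symmetric] using s sg \<theta>
      by (intro prb_not_quiet_le additive_subgroup_lattice_line) auto
    also have "\<dots> \<le> pi * (3 * (sqrt 2 * exp (1 / 2 * (real j * ln 2)))) / (1 - \<theta>)"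
    proof (intro frac_le mult_mono s_le)
      have "green (lattice_line a1 a2) (2 ^ j) \<le> 3 * sqrt (real (2 ^ j) + 1)"
        by (rule green_lattice_line_upper[OF assms(1)])
      also have "sqrt (real (2 ^ j) + 1) \<le> sqrt (2 * 2 ^ j)" by simp
      also have "\<dots> = sqrt 2 * exp (1 / 2 * (real j * ln 2))"
        by (simp only: real_sqrt_mult sqrt_two_power)
      finally show "green (lattice_line a1 a2) (2 ^ j) \<le> 3 * (sqrt 2 * exp (1 / 2 * (real j * ln 2)))" by simp
      show "0 \<le> green (lattice_line a1 a2) (2 ^ j)"
        using green_pos[OF additive_subgroup_lattice_line, of a1 a2 "2 ^ j"] by simp
    qed (use \<theta> sg in auto)
    finally have "?p j \<le> pi * (3 * (sqrt 2 * exp (1 / 2 * (real j * ln 2)))) / (1 - \<theta>) / (exp (\<beta> * (real j * ln 2)) / 2)"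
      by (subst pos_le_divide_eq) auto
    also have "\<dots> = 6 * sqrt 2 * pi / (1 - \<theta>) * (exp (1 / 2 * (real j * ln 2)) / exp (\<beta> * (real j * ln 2)))"
      by simp
    also have "exp (1 / 2 * (real j * ln 2)) / exp (\<beta> * (real j * ln 2)) = exp (- (\<beta> - 1 / 2) * (real j * ln 2))"
      by (simp add: exp_diff[symmetric] algebra_simps)
    finally show ?case .
  qed
  moreover have "\<beta> - 1 / 2 > 0" using \<beta> by simp
  ultimately show ?thesis by (intro summable_exp_decay[OF prb_nonneg])
qed

text \<open>The sum is the expectation of \<open>min \<tau> (N + 1)\<close>, where \<open>\<tau>\<close> is the first time after \<open>b\<close> on the line.\<close>

lemma sum_prb_avoids_le:
  assumes "a1 \<noteq> 0 \<or> a2 \<noteq> 0"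
  obtains D where "D > 0"
    "\<And>b N. b \<le> N \<Longrightarrow> (\<Sum>n\<le>N. prb n (avoids (lattice_line a1 a2) b)) \<le> D * sqrt (real b + 1) * sqrt (real N + 1)"
proof -
  let ?L = "lattice_line a1 a2"
  obtain c where c: "c > 0" "\<And>n. c * sqrt (real n + 1) \<le> green ?L n"
    using green_lattice_line_lower[OF assms] by blast
  have "(\<Sum>n\<le>N. prb n (avoids ?L b)) \<le> (1 + 6 / c) * sqrt (real b + 1) * sqrt (real N + 1)" if "b \<le> N" for b N
  proof -
    have "{..N} = {..b} \<union> {1 + b..N - b + b}" using that by auto
    then have "(\<Sum>n\<le>N. prb n (avoids ?L b))
      = (\<Sum>n\<le>b. prb n (avoids ?L b)) + (\<Sum>n=1 + b..N - b + b. prb n (avoids ?L b))"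
      by (simp only:) (rule sum.union_disjoint, auto)
    also have "(\<Sum>n\<le>b. prb n (avoids ?L b)) \<le> real b + 1"
      using sum_bounded_above[of "{..b}" "\<lambda>n. prb n (avoids ?L b)" 1] by simp
    also have "real b + 1 \<le> sqrt (real b + 1) * sqrt (real N + 1)"
    proof -
      have "real b + 1 = sqrt (real b + 1) * sqrt (real b + 1)" by simp
      also have "\<dots> \<le> sqrt (real b + 1) * sqrt (real N + 1)"
        using that by (intro mult_left_mono) auto
      finally show ?thesis .
    qed
    also have "(\<Sum>n=1 + b..N - b + b. prb n (avoids ?L b)) = (\<Sum>m=1..N - b. prb (m + b) (avoids ?L b))"
      by (rule sum.shift_bounds_cl_nat_ivl)
    also have "\<dots> \<le> (\<Sum>m=1..N - b. 3 * sqrt (real b + 1) / c * (1 / sqrt (real m)))"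
    proof (rule sum_mono)
      fix m assume "m \<in> {1..N - b}"
      then have m: "m > 0" by simp
      have "prb (m + b) (avoids ?L b) \<le> green ?L b / green ?L (m + b - b)"
        by (intro prb_avoids_le additive_subgroup_lattice_line) simp
      also have "\<dots> \<le> (3 * sqrt (real b + 1)) / (c * sqrt (real m))"
      proof (intro frac_le green_lattice_line_upper assms)
        have "c * sqrt (real m) \<le> c * sqrt (real m + 1)" using c by simp
        then show "c * sqrt (real m) \<le> green ?L (m + b - b)" using c(2)[of m] by simp
      qed (use c m in auto)
      finally show "prb (m + b) (avoids ?L b) \<le> 3 * sqrt (real b + 1) / c * (1 / sqrt (real m))" by simp
    qed
    also have "\<dots> = 3 * sqrt (real b + 1) / c * (\<Sum>m=1..N - b. 1 / sqrt (real m))"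
      by (simp only: sum_distrib_left)
    also have "\<dots> \<le> 3 * sqrt (real b + 1) / c * (2 * sqrt (real N + 1))"
    proof (rule mult_left_mono)
      have "(\<Sum>m=1..N - b. 1 / sqrt (real m)) \<le> 2 * sqrt (real (N - b))" by (rule sum_inverse_sqrt_le)
      also have "\<dots> \<le> 2 * sqrt (real N + 1)" by simp
      finally show "(\<Sum>m=1..N - b. 1 / sqrt (real m)) \<le> 2 * sqrt (real N + 1)" .
    qed (use c in simp)
    finally show ?thesis by (simp add: algebra_simps)
  qed
  moreover have "1 + 6 / c > 0" using c by (simp add: add_pos_pos)
  ultimately show ?thesis using that by blast
qed

text \<open>Attempts have length \<open>b\<close>, about \<open>\<surd>n\<close> for \<open>n = 2\<^sup>j\<close>. The time \<open>m = b div k\<close> available for one return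
  eventually exceeds \<open>n\<close> to the power \<open>\<kappa>\<close> for any fixed \<open>\<kappa> < 1/2\<close>, so an attempt succeeds with probability at
  least \<open>n\<close> to the power \<open>- \<beta>\<close> for any fixed \<open>\<beta> > a \<pi> / \<kappa>\<close>. The hypothesis on \<open>a\<close> leaves room for
  \<open>\<beta> < 1/4\<close>.\<close>

lemma summable_prb_quiet:
  assumes "a1 \<noteq> 0 \<or> a2 \<noteq> 0" "0 < a" "a < 1 / (8 * pi)"
  shows "summable (\<lambda>j. prb (2 ^ j) (quiet (lattice_line a1 a2) (threshold a j)))"
proof -
  let ?L = "lattice_line a1 a2"
  obtain D where D: "D > 0"
    "\<And>b N. b \<le> N \<Longrightarrow> (\<Sum>n\<le>N. prb n (avoids ?L b)) \<le> D * sqrt (real b + 1) * sqrt (real N + 1)"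
    using sum_prb_avoids_le[OF assms(1)] by blast
  have "4 * pi * a < 1 / 2" using assms(3) by (simp add: field_simps)
  then obtain \<kappa> where \<kappa>: "4 * pi * a < \<kappa>" "\<kappa> < 1 / 2" using dense by blast
  have \<kappa>0: "\<kappa> > 0" using \<kappa>(1) assms(2) by (meson less_trans mult_pos_pos pi_gt_zero zero_less_numeral)
  have "a * pi / \<kappa> < 1 / 4" using \<kappa> \<kappa>0 by (simp add: field_simps)
  then obtain \<beta> where \<beta>: "a * pi / \<kappa> < \<beta>" "\<beta> < 1 / 4" using dense by blast
  \<comment> \<open>With \<open>x = log n\<close>, this makes \<open>b / k\<close> at least \<open>exp (\<kappa> x) + 1\<close>; the 1 absorbs the
    rounding in \<open>b div k\<close>.\<close>
  have room: "\<forall>\<^sub>F x in at_top. (exp (\<kappa> * x) + 1) * (a * x\<^sup>2 + 1) \<le> exp ((x - ln 2) / 2)"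
    using \<kappa> \<kappa>0 assms(2) by real_asymp
  \<comment> \<open>Here \<open>\<kappa> x / \<pi>\<close> is a lower bound for the Green function \<open>G\<close> of the time available for one
    return, and \<open>(1 - 1/G)\<^sup>k\<close> is at least \<open>exp (- k / (G - 1))\<close>.\<close>
  have "((\<lambda>x. (a * x\<^sup>2 + 1) / (\<kappa> * x / pi - 1) / x) \<longlongrightarrow> a * (inverse \<kappa> * pi)) at_top"
    using \<kappa>0 assms(2) by real_asymp
  moreover have "a * (inverse \<kappa> * pi) = a * pi / \<kappa>" by (simp add: divide_inverse)
  ultimately have cost: "\<forall>\<^sub>F x in at_top. (a * x\<^sup>2 + 1) / (\<kappa> * x / pi - 1) / x < \<beta>"
    using \<beta> by (intro order_tendstoD(2)) auto
  have Hbig: "\<forall>\<^sub>F x in at_top. \<kappa> * x / pi > 1"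
    using \<kappa>0 by real_asymp
  have lim: "filterlim (\<lambda>j. real j * ln 2) at_top sequentially" by real_asymp
  have "\<forall>\<^sub>F x in at_top. (exp (\<kappa> * x) + 1) * (a * x\<^sup>2 + 1) \<le> exp ((x - ln 2) / 2)
      \<and> (a * x\<^sup>2 + 1) / (\<kappa> * x / pi - 1) / x < \<beta> \<and> \<kappa> * x / pi > 1 \<and> x > 0"
    using room cost Hbig eventually_gt_at_top[of 0] by eventually_elim simp
  from eventually_compose_filterlim[OF this lim]
  have "\<forall>\<^sub>F j in sequentially. prb (2 ^ j) (quiet ?L (threshold a j))
      \<le> D * sqrt 2 * exp (- (1 / 4 - \<beta>) * (real j * ln 2))"
  proof eventually_elim
    case (elim j)
    define x where "x = real j * ln 2"
    define k where "k = threshold a j"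
    define b where "b = (2::nat) ^ (j div 2)"
    define m where "m = b div k"
    define H where "H = \<kappa> * x / pi"
    define q where "q = prb (2 ^ j) (quiet ?L k)"
    have x: "(exp (\<kappa> * x) + 1) * (a * x\<^sup>2 + 1) \<le> exp ((x - ln 2) / 2)"
      "(a * x\<^sup>2 + 1) / (H - 1) / x < \<beta>" "H > 1" "x > 0"
      using elim unfolding x_def H_def by auto
    have j: "j > 0" using x(4) unfolding x_def by (cases j) auto
    have k: "k > 0" "real k \<le> a * x\<^sup>2 + 1"
      unfolding k_def x_def using threshold_pos[OF assms(2) j] threshold_le[of a j] assms(2) by auto
    have b: "exp ((x - ln 2) / 2) \<le> real b" "real b \<le> exp (x / 2)"
    proof -
      have "real b = exp (real (j div 2) * ln 2)" unfolding b_def by (simp add: exp_of_nat_mult)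
      moreover have "real j \<le> 2 * real (j div 2) + 1" by linarith
      moreover have "2 * real (j div 2) \<le> real j" by linarith
      ultimately have b_eq: "real b = exp (real (j div 2) * ln 2)"
        and "(real j - 1) / 2 \<le> real (j div 2)" "real (j div 2) \<le> real j / 2" by simp_all
      then have "(real j - 1) / 2 * ln 2 \<le> real (j div 2) * ln 2" "real (j div 2) * ln 2 \<le> real j / 2 * ln 2"
        by (intro mult_right_mono; simp)+
      then have "(x - ln 2) / 2 \<le> real (j div 2) * ln 2" "real (j div 2) * ln 2 \<le> x / 2"
        unfolding x_def by (simp_all add: field_simps)
      with b_eq show "exp ((x - ln 2) / 2) \<le> real b" "real b \<le> exp (x / 2)" by simp_all
    qed
    have bN: "b \<le> 2 ^ j" unfolding b_def by (intro power_increasing) auto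
    have m: "exp (\<kappa> * x) \<le> real m"
    proof -
      have "(exp (\<kappa> * x) + 1) * real k \<le> (exp (\<kappa> * x) + 1) * (a * x\<^sup>2 + 1)"
        using k by (intro mult_left_mono) (auto intro: add_nonneg_nonneg)
      also have "\<dots> \<le> real b" using x(1) b(1) by linarith
      finally have "exp (\<kappa> * x) + 1 \<le> real b / real k" using k(1) by (simp add: field_simps)
      moreover have "real b / real k \<le> real m + 1"
      proof -
        have "real b = real (k * m + b mod k)" unfolding m_def by simp
        also have "\<dots> \<le> real k * (real m + 1)" using k(1) by (simp add: distrib_left less_imp_le)
        finally show ?thesis using k(1) by (simp add: field_simps)
      qed
      ultimately show ?thesis by linarith
    qed
    have m0: "m > 0" using less_le_trans[OF exp_gt_zero m] by simp
    have G: "H \<le> green {0} m"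
    proof -
      have "\<kappa> * x \<le> ln (real m)" using m m0 by (subst ln_ge_iff) auto
      then have "H \<le> ln (real m) / pi" unfolding H_def by (intro divide_right_mono) auto
      then show ?thesis using green_zero_lower[OF m0] by linarith
    qed
    have p: "exp (- (\<beta> * x)) \<le> prb b (\<lambda>w. k \<le> visits 0 w)"
    proof -
      have "real k / (H - 1) \<le> (a * x\<^sup>2 + 1) / (H - 1)" using k(2) x(3) by (intro divide_right_mono) auto
      also have "\<dots> \<le> \<beta> * x" using x(2,4) by (simp only: pos_divide_less_eq less_imp_le)
      finally have "exp (- (\<beta> * x)) \<le> exp (- (real k / (H - 1)))" by simp
      also have "\<dots> \<le> (1 - 1 / H) ^ k" by (rule exp_le_one_minus_power[OF x(3)])
      also have "\<dots> \<le> (1 - 1 / green {0} m) ^ k"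
        using G x(3) by (intro power_mono diff_left_mono divide_left_mono) auto
      also have "\<dots> \<le> prb b (\<lambda>w. k \<le> visits 0 w)"
        unfolding m_def by (intro prb_many_returns_ge_green) simp
      finally show ?thesis .
    qed
    have "(2 ^ j + 1) * (q * exp (- (\<beta> * x))) \<le> (real (2 ^ j) + 1) * q * prb b (\<lambda>w. k \<le> visits 0 w)"
      unfolding mult.assoc using p by (intro mult_mono) (auto simp: q_def)
    also have "\<dots> \<le> (\<Sum>n\<le>2 ^ j. prb n (avoids ?L b))"
      unfolding q_def by (intro prb_quiet_le additive_subgroup_lattice_line bN)
    also have "\<dots> \<le> D * sqrt (real b + 1) * sqrt (real (2 ^ j) + 1)" using D(2)[OF bN] .
    finally have "(2 ^ j + 1) * (q * exp (- (\<beta> * x))) \<le> D * sqrt (real b + 1) * sqrt (2 ^ j + 1)" by simp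
    note bound = this
    define r :: real where "r = sqrt (2 ^ j + 1)"
    have r: "r * r = 2 ^ j + 1" "r > 0" unfolding r_def by (simp_all add: add_pos_pos)
    have "(r * r) * (q * exp (- (\<beta> * x))) \<le> D * sqrt (real b + 1) * r"
      using bound unfolding r(1) unfolding r_def .
    then have "r * (r * (q * exp (- (\<beta> * x)))) \<le> r * (D * sqrt (real b + 1))" by (simp only: mult_ac)
    then have "r * (q * exp (- (\<beta> * x))) \<le> D * sqrt (real b + 1)"
      using r(2) by (rule mult_left_le_imp_le)
    moreover have "sqrt (2 ^ j) * (q * exp (- (\<beta> * x))) \<le> r * (q * exp (- (\<beta> * x)))"
      unfolding r_def by (intro mult_right_mono) (auto simp: q_def)
    moreover have "D * sqrt (real b + 1) \<le> D * (sqrt 2 * exp (x / 4))"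
    proof (rule mult_left_mono)
      have "1 \<le> real b" unfolding b_def by simp
      then have "real b + 1 \<le> 2 * exp (x / 2)" using b(2) by linarith
      then have "sqrt (real b + 1) \<le> sqrt (2 * (exp (x / 4))\<^sup>2)" by (simp add: exp_double[symmetric])
      then show "sqrt (real b + 1) \<le> sqrt 2 * exp (x / 4)" by (simp add: real_sqrt_mult)
    qed (use D(1) in simp)
    ultimately have "exp (1 / 2 * x) * (q * exp (- (\<beta> * x))) \<le> D * (sqrt 2 * exp (x / 4))"
      unfolding x_def sqrt_two_power by linarith
    then have "q \<le> D * (sqrt 2 * exp (x / 4)) / (exp (1 / 2 * x) * exp (- (\<beta> * x)))"
      by (subst pos_le_divide_eq) (auto simp: mult_ac)
    also have "\<dots> = D * sqrt 2 * exp (x / 4 - (1 / 2 * x + - (\<beta> * x)))"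
      unfolding exp_diff exp_add by simp
    also have "x / 4 - (1 / 2 * x + - (\<beta> * x)) = - (1 / 4 - \<beta>) * x" by (simp add: algebra_simps)
    finally show ?case unfolding q_def k_def x_def .
  qed
  moreover have "1 / 4 - \<beta> > 0" using \<beta> by simp
  ultimately show ?thesis by (intro summable_exp_decay[OF prb_nonneg])
qed

section \<open>From words to the random walk\<close>

lemma avg_eq_sum_words:
  "avg n f = (\<Sum>w | set w \<subseteq> steps \<and> length w = n. f w) / 4 ^ n"
proof (induction n arbitrary: f)
  case 0
  have "{w. set w \<subseteq> steps \<and> length w = 0} = {[]}" by auto
  then show ?case by simp
next
  case (Suc n)
  let ?W = "{w. set w \<subseteq> steps \<and> length w = n}"
  have "(\<Sum>w | set w \<subseteq> steps \<and> length w = Suc n. f w) = (\<Sum>(w, s)\<in>?W \<times> steps. f (s # w))"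
    unfolding lists_length_Suc_eq by (subst sum.reindex) (auto simp: inj_on_def case_prod_beta)
  also have "\<dots> = (\<Sum>s\<in>steps. \<Sum>w\<in>?W. f (s # w))"
    unfolding sum.cartesian_product[symmetric] by (rule sum.swap)
  finally show ?case by (simp add: Suc.IH sum_divide_distrib mult.commute)
qed

definition trajectory :: "(nat \<Rightarrow> 'a \<Rightarrow> int \<times> int) \<Rightarrow> nat \<Rightarrow> 'a \<Rightarrow> (int \<times> int) list" where
  "trajectory X n \<omega> = map (\<lambda>k. X k \<omega>) [1..<Suc n]"

lemma length_trajectory [simp]: "length (trajectory X n \<omega>) = n"
  by (simp add: trajectory_def)

lemma trajectory_eq_iff:
  "trajectory X n \<omega> = w \<longleftrightarrow> length w = n \<and> (\<forall>k\<in>{1..n}. X k \<omega> = w ! (k - 1))"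
proof -
  have "(\<forall>i<n. X (Suc i) \<omega> = w ! i) \<longleftrightarrow> (\<forall>k\<in>{1..n}. X k \<omega> = w ! (k - 1))"
    by (metis One_nat_def Suc_le_eq Suc_pred' atLeastAtMost_iff diff_Suc_1 zero_less_Suc less_Suc_eq_le Suc_le_mono)
  then show ?thesis by (auto simp: trajectory_def list_eq_iff_nth_eq simp del: upt_Suc)
qed

lemma walk_eq_sum_list: "t \<le> n \<Longrightarrow> walk X t \<omega> = sum_list (take t (trajectory X n \<omega>))"
proof -
  assume "t \<le> n"
  then have "take t (trajectory X n \<omega>) = map (\<lambda>k. X k \<omega>) [1..<Suc t]"
    unfolding trajectory_def take_map by (subst take_upt) auto
  then show ?thesis
    unfolding walk_def by (simp only: interv_sum_list_conv_sum_set_nat set_upt atLeastLessThanSuc_atLeastAtMost)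
qed

lemma local_time_eq_visits: "local_time X x n \<omega> = visits x (trajectory X n \<omega>)"
  unfolding local_time_def visits_def by (rule arg_cong[of _ _ card]) (auto simp: walk_eq_sum_list)

lemma max_local_time_less_iff:
  assumes "A \<noteq> {}"
  shows "max_local_time X A n \<omega> < k \<longleftrightarrow> quiet A k (trajectory X n \<omega>)"
  unfolding max_local_time_def quiet_def using assms finite_local_time_image[of X n \<omega> A]
  by (subst Max_less_iff) (simp_all add: local_time_eq_visits)

lemma max_local_time_mono:
  assumes "A \<noteq> {}" "m \<le> n"
  shows "max_local_time X A m \<omega> \<le> max_local_time X A n \<omega>"
proof -
  have "quiet A (Suc (max_local_time X A n \<omega>)) (trajectory X n \<omega>)"
    using assms(1) by (simp add: max_local_time_less_iff[symmetric])
  moreover have "take m (trajectory X n \<omega>) = trajectory X m \<omega>"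
    using assms(2) unfolding trajectory_def take_map by (subst take_upt) auto
  ultimately have "quiet A (Suc (max_local_time X A n \<omega>)) (trajectory X m \<omega>)"
    using quiet_take by metis
  then show ?thesis using assms(1) by (simp add: max_local_time_less_iff[symmetric] less_Suc_eq_le)
qed

context simple_random_walk_2d
begin

lemma step_measurable: "k \<ge> 1 \<Longrightarrow> X k \<in> measurable M (count_space UNIV)"
  using indep_steps by (simp add: indep_vars_def2)

lemma prob_step:
  assumes "k \<ge> 1" "v \<in> steps"
  shows "prob (X k -` {v} \<inter> space M) = 1 / 4"
proof -
  have "prob (X k -` {v} \<inter> space M) = measure (distr M (count_space UNIV) (X k)) {v}"
    using assms by (subst measure_distr) (auto intro: step_measurable)
  also have "\<dots> = measure (distr M (count_space UNIV) (X 1)) {v}"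
    using ident_distrib_steps[OF assms(1)] by simp
  also have "\<dots> = prob (X 1 -` {v} \<inter> space M)"
    by (subst measure_distr) (auto intro: step_measurable)
  also have "X 1 -` {v} \<inter> space M = {\<omega> \<in> space M. X 1 \<omega> = v}" by auto
  also have "prob \<dots> = 1 / 4" using assms(2) by (intro step_prob) (simp add: steps_def)
  finally show ?thesis .
qed

lemma trajectory_measurable: "trajectory X n \<in> measurable M (count_space UNIV)"
proof -
  have "trajectory X n -` {w} \<inter> space M \<in> sets M" for w
  proof (cases "length w = n")
    case True
    have "trajectory X n -` {w} \<inter> space M = {\<omega> \<in> space M. \<forall>k\<in>{1..n}. X k \<omega> = w ! (k - 1)}"
      using True by (auto simp: trajectory_eq_iff)
    also have "\<dots> \<in> sets M"
    proof (rule sets.sets_Collect_finite_All)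
      fix k assume "k \<in> {1..n}"
      then have "X k -` {w ! (k - 1)} \<inter> space M \<in> sets M"
        by (intro measurable_sets[OF step_measurable]) auto
      moreover have "{\<omega> \<in> space M. X k \<omega> = w ! (k - 1)} = X k -` {w ! (k - 1)} \<inter> space M" by auto
      ultimately show "{\<omega> \<in> space M. X k \<omega> = w ! (k - 1)} \<in> sets M" by simp
    qed simp
    finally show ?thesis .
  next
    case False
    then have "trajectory X n -` {w} \<inter> space M = {}" by (auto simp: trajectory_eq_iff)
    then show ?thesis by simp
  qed
  then show ?thesis by (simp add: measurable_count_space_eq2_countable)
qed

lemma trajectory_event [measurable]: "{\<omega> \<in> space M. A (trajectory X n \<omega>)} \<in> events"
proof -
  have "{\<omega> \<in> space M. A (trajectory X n \<omega>)} = trajectory X n -` Collect A \<inter> space M" by auto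
  then show ?thesis using measurable_sets[OF trajectory_measurable, of "Collect A" n] by simp
qed

lemma prob_trajectory_word:
  assumes "set w \<subseteq> steps" "length w = n"
  shows "prob {\<omega> \<in> space M. trajectory X n \<omega> = w} = 1 / 4 ^ n"
proof (cases "n = 0")
  case True
  then have "{\<omega> \<in> space M. trajectory X n \<omega> = w} = space M" using assms by (simp add: trajectory_eq_iff)
  then show ?thesis using True prob_space by simp
next
  case False
  then have ne: "{1..n} \<noteq> {}" by simp
  have "{\<omega> \<in> space M. trajectory X n \<omega> = w} = (\<Inter>k\<in>{1..n}. X k -` {w ! (k - 1)} \<inter> space M)"
    using assms(2) ne by (auto simp: trajectory_eq_iff)
  also have "prob \<dots> = (\<Prod>k\<in>{1..n}. prob (X k -` {w ! (k - 1)} \<inter> space M))"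
    using ne by (intro indep_varsD[OF indep_steps]) auto
  also have "\<dots> = (\<Prod>k\<in>{1..n}. 1 / 4)"
  proof (rule prod.cong[OF refl])
    fix k assume "k \<in> {1..n}"
    then have "w ! (k - 1) \<in> steps" using assms by (intro subsetD[OF assms(1)] nth_mem) auto
    then show "prob (X k -` {w ! (k - 1)} \<inter> space M) = 1 / 4"
      using \<open>k \<in> {1..n}\<close> by (intro prob_step) auto
  qed
  finally show ?thesis by (simp add: power_one_over)
qed

lemma prob_trajectory_ge: "prb n A \<le> prob {\<omega> \<in> space M. A (trajectory X n \<omega>)}"
proof -
  let ?W = "{w. set w \<subseteq> steps \<and> length w = n}"
  have fin: "finite ?W" by (rule finite_lists_length_eq) (simp add: steps_def)
  let ?E = "\<lambda>w. {\<omega> \<in> space M. trajectory X n \<omega> = w}"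
  have "prb n A = (\<Sum>w\<in>?W \<inter> Collect A. 1 / 4 ^ n)"
    unfolding prb_def avg_eq_sum_words using fin by (simp add: sum_of_bool_eq)
  also have "\<dots> = (\<Sum>w\<in>?W \<inter> Collect A. prob (?E w))"
    by (intro sum.cong refl prob_trajectory_word[symmetric]) auto
  also have "\<dots> = prob (\<Union>w\<in>?W \<inter> Collect A. ?E w)"
    using fin by (intro finite_measure_finite_Union[symmetric]) (auto simp: disjoint_family_on_def trajectory_event)
  also have "\<dots> \<le> prob {\<omega> \<in> space M. A (trajectory X n \<omega>)}"
    by (intro finite_measure_mono trajectory_event) auto
  finally show ?thesis .
qed

text \<open>Words over the four steps already have total probability 1, so the lower bounds for an event and for
  its complement add up to 1 and both are attained.\<close>

lemma prob_trajectory_le: "prob {\<omega> \<in> space M. A (trajectory X n \<omega>)} \<le> prb n A"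
proof -
  have "1 - prb n A \<le> prob {\<omega> \<in> space M. \<not> A (trajectory X n \<omega>)}"
    using prob_trajectory_ge[of n "\<lambda>w. \<not> A w"] by (simp add: prb_not)
  also have "\<dots> = 1 - prob {\<omega> \<in> space M. A (trajectory X n \<omega>)}"
    by (intro prob_neg trajectory_event)
  finally show ?thesis by simp
qed

lemma AE_eventually_not_trajectory:
  assumes "summable (\<lambda>j. prb (N j) (A j))"
  shows "AE \<omega> in M. eventually (\<lambda>j. \<not> A j (trajectory X (N j) \<omega>)) sequentially"
proof -
  let ?E = "\<lambda>j. {\<omega> \<in> space M. A j (trajectory X (N j) \<omega>)}"
  have "summable (\<lambda>j. prob (?E j))"
    by (rule summable_comparison_test'[OF assms, of 0]) (simp add: prob_trajectory_le)
  then have "AE \<omega> in M. eventually (\<lambda>j. \<omega> \<in> space M - ?E j) sequentially"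
    by (intro borel_cantelli_AE1) (auto simp: trajectory_event less_top[symmetric])
  then show ?thesis by eventually_elim (auto elim: eventually_mono)
qed

lemma AE_max_local_time_dyadic_upper:
  assumes "a1 \<noteq> 0 \<or> a2 \<noteq> 0" "a > 1 / (2 * pi)"
  shows "AE \<omega> in M. eventually (\<lambda>j. real (max_local_time X (lattice_line a1 a2) (2 ^ j) \<omega>)
    \<le> a * (real j * ln 2)\<^sup>2) sequentially"
proof -
  from AE_eventually_not_trajectory[OF summable_prb_not_quiet[OF assms]]
  show ?thesis
  proof eventually_elim
    case (elim \<omega>)
    then show ?case
    proof eventually_elim
      case (elim j)
      then have "max_local_time X (lattice_line a1 a2) (2 ^ j) \<omega> < threshold a j"
        by (simp add: max_local_time_less_iff[OF lattice_line_nonempty])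
      then show ?case unfolding threshold_def by linarith
    qed
  qed
qed

lemma AE_max_local_time_dyadic_lower:
  assumes "a1 \<noteq> 0 \<or> a2 \<noteq> 0" "0 < a" "a < 1 / (8 * pi)"
  shows "AE \<omega> in M. eventually (\<lambda>j. a * (real j * ln 2)\<^sup>2
    \<le> real (max_local_time X (lattice_line a1 a2) (2 ^ j) \<omega>)) sequentially"
proof -
  from AE_eventually_not_trajectory[OF summable_prb_quiet[OF assms]]
  show ?thesis
  proof eventually_elim
    case (elim \<omega>)
    then show ?case
    proof eventually_elim
      case (elim j)
      then have "threshold a j \<le> max_local_time X (lattice_line a1 a2) (2 ^ j) \<omega>"
        using max_local_time_less_iff[OF lattice_line_nonempty] by (meson not_less)
      then show ?case using threshold_ge[of a j] by linarith
    qed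
  qed
qed

end

section \<open>Interpolation between powers of two\<close>

lemma dyadic_bracket:
  assumes "n \<ge> 1"
  obtains j where "(2::nat) ^ j \<le> n" "n \<le> 2 ^ Suc j"
    "ln (real n) - ln 2 \<le> real j * ln 2" "real j * ln 2 \<le> ln (real n)"
proof -
  obtain j where j: "(2::nat) ^ j \<le> n" "n < 2 ^ (j + 1)"
    using ex_power_ivl1[of 2 n] assms by auto
  have "ln (real (2 ^ j)) \<le> ln (real n)" using j(1) by (intro ln_mono) (auto simp del: of_nat_power)
  moreover have "ln (real n) \<le> ln (real (2 ^ Suc j))"
    using j(2) assms by (intro ln_mono) (auto simp del: of_nat_power power_Suc)
  moreover have "ln (real (2 ^ i)) = real i * ln 2" for i by (simp add: ln_realpow)
  ultimately have "real j * ln 2 \<le> ln (real n)" "ln (real n) \<le> real (Suc j) * ln 2"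
    by (simp_all only:)
  then show ?thesis using that[of j] j by (simp add: algebra_simps)
qed

lemma limsup_le_of_dyadic:
  fixes f :: "nat \<Rightarrow> nat"
  assumes "mono f" "a \<ge> 0" "eventually (\<lambda>j. real (f (2 ^ j)) \<le> a * (real j * ln 2)\<^sup>2) sequentially"
  shows "limsup (\<lambda>n. ereal (real (f n) / (ln (real n))\<^sup>2)) \<le> ereal a"
proof -
  obtain J where J: "\<And>j. j \<ge> J \<Longrightarrow> real (f (2 ^ j)) \<le> a * (real j * ln 2)\<^sup>2"
    using assms(3) unfolding eventually_sequentially by blast
  have "\<forall>\<^sub>F n in sequentially. ereal (real (f n) / (ln (real n))\<^sup>2) \<le> ereal (a * ((ln (real n) + ln 2) / ln (real n))\<^sup>2)"
    using eventually_ge_at_top[of "max 2 (2 ^ J)"]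
  proof eventually_elim
    case (elim n)
    then have "2 \<le> n" by (simp only: max.bounded_iff)
    then have "n \<ge> 1" by simp
    then obtain j where j: "(2::nat) ^ j \<le> n" "n \<le> 2 ^ Suc j" "real j * ln 2 \<le> ln (real n)"
      by (rule dyadic_bracket)
    have "2 ^ J \<le> n" using elim by (simp only: max.bounded_iff)
    then have "(2::nat) ^ J \<le> 2 ^ Suc j" using j(2) by (rule order_trans)
    then have "J \<le> Suc j" by (metis one_less_numeral_iff power_increasing_iff semiring_norm(76))
    have "real (f n) \<le> real (f (2 ^ Suc j))" using monoD[OF assms(1) j(2)] by simp
    also have "\<dots> \<le> a * (real (Suc j) * ln 2)\<^sup>2" by (rule J) fact
    also have "\<dots> \<le> a * (ln (real n) + ln 2)\<^sup>2"
      using j(3) assms(2) by (intro mult_left_mono power_mono) (auto simp: algebra_simps)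
    finally have "real (f n) / (ln (real n))\<^sup>2 \<le> a * (ln (real n) + ln 2)\<^sup>2 / (ln (real n))\<^sup>2"
      by (rule divide_right_mono) simp
    then show ?case by (simp add: power_divide)
  qed
  then have "limsup (\<lambda>n. ereal (real (f n) / (ln (real n))\<^sup>2))
    \<le> limsup (\<lambda>n. ereal (a * ((ln (real n) + ln 2) / ln (real n))\<^sup>2))" by (rule Limsup_mono)
  also have "\<dots> = ereal a"
  proof (rule lim_imp_Limsup)
    have "(\<lambda>n. ((ln (real n) + ln 2) / ln (real n))\<^sup>2) \<longlonglongrightarrow> 1" by real_asymp
    then have "(\<lambda>n. a * ((ln (real n) + ln 2) / ln (real n))\<^sup>2) \<longlonglongrightarrow> a * 1" by (intro tendsto_intros)
    then show "(\<lambda>n. ereal (a * ((ln (real n) + ln 2) / ln (real n))\<^sup>2)) \<longlonglongrightarrow> ereal a" by simp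
  qed simp
  finally show ?thesis .
qed

lemma liminf_ge_of_dyadic:
  fixes f :: "nat \<Rightarrow> nat"
  assumes "mono f" "a \<ge> 0" "eventually (\<lambda>j. a * (real j * ln 2)\<^sup>2 \<le> real (f (2 ^ j))) sequentially"
  shows "ereal a \<le> liminf (\<lambda>n. ereal (real (f n) / (ln (real n))\<^sup>2))"
proof -
  obtain J where J: "\<And>j. j \<ge> J \<Longrightarrow> a * (real j * ln 2)\<^sup>2 \<le> real (f (2 ^ j))"
    using assms(3) unfolding eventually_sequentially by blast
  have "\<forall>\<^sub>F n in sequentially. ereal (a * ((ln (real n) - ln 2) / ln (real n))\<^sup>2) \<le> ereal (real (f n) / (ln (real n))\<^sup>2)"
    using eventually_ge_at_top[of "max 2 (2 ^ Suc J)"]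
  proof eventually_elim
    case (elim n)
    then have "2 \<le> n" by (simp only: max.bounded_iff)
    then have "n \<ge> 1" by simp
    then obtain j where j: "(2::nat) ^ j \<le> n" "n \<le> 2 ^ Suc j" "ln (real n) - ln 2 \<le> real j * ln 2"
      by (rule dyadic_bracket)
    have "2 ^ Suc J \<le> n" using elim by (simp only: max.bounded_iff)
    then have "(2::nat) ^ Suc J \<le> 2 ^ Suc j" using j(2) by (rule order_trans)
    then have "J \<le> j" by simp
    have "ln 2 \<le> ln (real n)" using \<open>2 \<le> n\<close> by (intro ln_mono) auto
    then have "a * (ln (real n) - ln 2)\<^sup>2 \<le> a * (real j * ln 2)\<^sup>2"
      using j(3) assms(2) by (intro mult_left_mono power_mono) auto
    also have "\<dots> \<le> real (f (2 ^ j))" by (rule J) fact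
    also have "\<dots> \<le> real (f n)" using monoD[OF assms(1) j(1)] by simp
    finally have "a * (ln (real n) - ln 2)\<^sup>2 / (ln (real n))\<^sup>2 \<le> real (f n) / (ln (real n))\<^sup>2"
      by (rule divide_right_mono) simp
    then show ?case by (simp add: power_divide)
  qed
  then have "liminf (\<lambda>n. ereal (a * ((ln (real n) - ln 2) / ln (real n))\<^sup>2))
    \<le> liminf (\<lambda>n. ereal (real (f n) / (ln (real n))\<^sup>2))" by (rule Liminf_mono)
  moreover have "liminf (\<lambda>n. ereal (a * ((ln (real n) - ln 2) / ln (real n))\<^sup>2)) = ereal a"
  proof (rule lim_imp_Liminf)
    have "(\<lambda>n. ((ln (real n) - ln 2) / ln (real n))\<^sup>2) \<longlonglongrightarrow> 1" by real_asymp
    then have "(\<lambda>n. a * ((ln (real n) - ln 2) / ln (real n))\<^sup>2) \<longlonglongrightarrow> a * 1" by (intro tendsto_intros)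
    then show "(\<lambda>n. ereal (a * ((ln (real n) - ln 2) / ln (real n))\<^sup>2)) \<longlonglongrightarrow> ereal a" by simp
  qed simp
  ultimately show ?thesis by simp
qed

section \<open>Maximal local time on a line through the origin\<close>

theorem theorem1p1:
  fixes M :: "'a measure" and X :: "nat \<Rightarrow> 'a \<Rightarrow> int \<times> int" and a1 a2 :: int
  assumes "simple_random_walk_2d M X"
    and "a1 \<noteq> 0 \<or> a2 \<noteq> 0"
  shows "AE \<omega> in M.
      ereal (1 / (8 * pi))
        \<le> liminf (\<lambda>n. ereal (real (max_local_time X (lattice_line a1 a2) n \<omega>) / (ln (real n))\<^sup>2)) \<and>
      liminf (\<lambda>n. ereal (real (max_local_time X (lattice_line a1 a2) n \<omega>) / (ln (real n))\<^sup>2))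
        \<le> limsup (\<lambda>n. ereal (real (max_local_time X (lattice_line a1 a2) n \<omega>) / (ln (real n))\<^sup>2)) \<and>
      limsup (\<lambda>n. ereal (real (max_local_time X (lattice_line a1 a2) n \<omega>) / (ln (real n))\<^sup>2))
        \<le> ereal (1 / (2 * pi))"
proof -
  interpret simple_random_walk_2d M X by fact
  let ?L = "lattice_line a1 a2"
  let ?r = "\<lambda>\<omega> n. ereal (real (max_local_time X ?L n \<omega>) / (ln (real n))\<^sup>2)"
  \<comment> \<open>Countably many constants approximating the bounds suffice, so the exceptional sets stay null.\<close>
  define u where "u = (\<lambda>i. 1 / (2 * pi) + 1 / real (Suc i))"
  define l where "l = (\<lambda>i. 1 / (8 * pi) * (1 - 1 / real (i + 2)))"
  have u: "u i > 1 / (2 * pi)" for i unfolding u_def by simp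
  have l_pos: "0 < l i" for i unfolding l_def by (intro mult_pos_pos) simp_all
  have "l i < 1 / (8 * pi) * 1" for i unfolding l_def by (intro mult_strict_left_mono) simp_all
  then have l_less: "l i < 1 / (8 * pi)" for i by simp
  have u_lim: "u \<longlonglongrightarrow> 1 / (2 * pi)" unfolding u_def by real_asymp
  have l_lim: "l \<longlonglongrightarrow> 1 / (8 * pi)" unfolding l_def by real_asymp
  have mono: "mono (\<lambda>n. max_local_time X ?L n \<omega>)" for \<omega>
    by (intro monoI max_local_time_mono lattice_line_nonempty)
  have "AE \<omega> in M. \<forall>i. eventually (\<lambda>j. real (max_local_time X ?L (2 ^ j) \<omega>) \<le> u i * (real j * ln 2)\<^sup>2) sequentially"
    unfolding AE_all_countable using AE_max_local_time_dyadic_upper[OF assms(2) u] by blast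
  moreover have "AE \<omega> in M. \<forall>i. eventually (\<lambda>j. l i * (real j * ln 2)\<^sup>2 \<le> real (max_local_time X ?L (2 ^ j) \<omega>)) sequentially"
    unfolding AE_all_countable using AE_max_local_time_dyadic_lower[OF assms(2) l_pos l_less] by blast
  ultimately show ?thesis
  proof eventually_elim
    case (elim \<omega>)
    have "limsup (?r \<omega>) \<le> ereal (u i)" for i
      using limsup_le_of_dyadic[OF mono, of "u i" \<omega>] elim(1) u[of i] less_trans[OF _ u[of i], of 0] by simp
    then have upper: "limsup (?r \<omega>) \<le> ereal (1 / (2 * pi))"
      using u_lim by (intro LIMSEQ_le_const[of "\<lambda>i. ereal (u i)"]) auto
    have "ereal (l i) \<le> liminf (?r \<omega>)" for i
      using liminf_ge_of_dyadic[OF mono, of "l i" \<omega>] elim(2) l_pos[of i] by simp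
    then have lower: "ereal (1 / (8 * pi)) \<le> liminf (?r \<omega>)"
      using l_lim by (intro LIMSEQ_le_const2[of "\<lambda>i. ereal (l i)"]) auto
    have "liminf (?r \<omega>) \<le> limsup (?r \<omega>)" by (rule Liminf_le_Limsup) simp
    with upper lower show ?case by blast
  qed
qed

end
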